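(* Let $\alpha\in(0,1)$. Assume that $G$ is concave. Let $T=t(\hat a,\widehat G)$ be a plug-in threshold, where $\widehat G$ is the empirical distribution function of $P_1,\dots,P_m$ or its least concave majorant, and where $\hat a=\hat a_m$ is an estimator with $\hat a\xrightarrow{P}a_0$ for some $a_0<a$. Then, as $m\to\infty$, $$\mathsf E\,\Gamma(T)\le\alpha+o(1).$$
   Context: Model: for each $m$, the pairs $(P_i,H_i)$, $i=1,\dots,m$, are i.i.d. with $H_i\sim\text{Bernoulli}(a)$, $0\le a\le1$; conditionally on $H_i=0$, $P_i$ is Uniform$(0,1)$; conditionally on $H_i=1$, $P_i$ has distribution function $F$ on $[0,1]$ with $F(t)\ge t$ for all $t$. The marginal distribution function of $P_i$ is $G(t)=(1-a)t+aF(t)$, with density $g=G'$. For $b\in[0,1]$ and a distribution function $K$ on $[0,1]$, the threshold functional at level $\alpha$ is $$t(b,K)=\sup\left\{t\in[0,1]:\frac{(1-b)t}{K(t)}\le\alpha\right\}.$$ The FDP process is $$\Gamma(t)=\frac{\sum_{i=1}^m \mathbf 1\{P_i\le t\}(1-H_i)}{\sum_{i=1}^m \mathbf 1\{P_i\le t\}+\mathbf 1\{\text{all }P_i>t\}},$$ and $\Gamma(T)$ is its evaluation at the random threshold $T$. An estimator is a measurable function of $P_1,\dots,P_m$, here with values in $[0,1]$. *)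

theory Defs
  imports "HOL-Probability.Probability" "HOL-Library.Landau_Symbols"
begin

definition is_cdf_unit :: "(real \<Rightarrow> real) \<Rightarrow> bool" where
  "is_cdf_unit K \<longleftrightarrow>
     mono K \<and> (\<forall>t. continuous (at_right t) K) \<and> (\<forall>t<0. K t = 0) \<and> (\<forall>t\<ge>1. K t = 1)"

text \<open>The first summand is the uniform distribution function only for arguments in
  \<open>[0,1]\<close>; the function is only ever used there.\<close>

definition mixture_cdf :: "real \<Rightarrow> (real \<Rightarrow> real) \<Rightarrow> real \<Rightarrow> real" where
  "mixture_cdf a F t = (1 - a) * t + a * F t"

locale two_groups =
  fixes a :: real and F g :: "real \<Rightarrow> real"
  assumes a_nonneg: "0 \<le> a" and a_le_1: "a \<le> 1"
    and F_cdf: "is_cdf_unit F"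
    and F_ge: "\<And>t. t \<in> {0..1} \<Longrightarrow> t \<le> F t"
    and g_integrable: "set_integrable lborel {0..1} g"
    and g_density: "\<And>t. t \<in> {0..1} \<Longrightarrow> mixture_cdf a F t = (LINT x:{0..t}|lborel. g x)"
    and g_deriv: "AE x in lborel. x \<in> {0<..<1} \<longrightarrow>
                    (mixture_cdf a F has_real_derivative g x) (at x)"

text \<open>The conditional law of \<open>P i\<close> given an event \<open>A\<close> of positive probability is the
  push-forward under \<open>P i\<close> of \<open>uniform_measure M A\<close>, that is of
  \<open>B \<mapsto> Pr(A \<inter> B) / Pr(A)\<close>. The guards \<open>a < 1\<close> and \<open>0 < a\<close> exclude
  conditioning on a null event.\<close>

locale two_groups_sample = two_groups a F g + prob_space M
  for a :: real and F g :: "real \<Rightarrow> real" and M :: "'a measure" +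
  fixes m :: nat
    and P :: "nat \<Rightarrow> 'a \<Rightarrow> real"
    and H :: "nat \<Rightarrow> 'a \<Rightarrow> bool"
  assumes indep_pairs:
      "indep_vars (\<lambda>_. borel \<Otimes>\<^sub>M count_space UNIV) (\<lambda>i \<omega>. (P i \<omega>, H i \<omega>)) {1..m}"
    and H_bernoulli:
      "\<And>i. i \<in> {1..m} \<Longrightarrow> distr M (count_space UNIV) (H i) = measure_pmf (bernoulli_pmf a)"
    and P_null:
      "\<And>i. i \<in> {1..m} \<Longrightarrow> a < 1 \<Longrightarrow>
         distr (uniform_measure M {\<omega> \<in> space M. \<not> H i \<omega>}) borel (P i)
           = uniform_measure lborel {0<..<1}"
    and P_alternative:
      "\<And>i. i \<in> {1..m} \<Longrightarrow> 0 < a \<Longrightarrow>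
         cdf (distr (uniform_measure M {\<omega> \<in> space M. H i \<omega>}) borel (P i)) = F"

definition empirical_cdf :: "nat \<Rightarrow> (nat \<Rightarrow> real) \<Rightarrow> real \<Rightarrow> real" where
  "empirical_cdf m p t = real (card {i \<in> {1..m}. p i \<le> t}) / real m"

text \<open>Pointwise infimum of all concave majorants on \<open>[0,1]\<close>. For \<open>K\<close> bounded there,
  this is itself concave on \<open>[0,1]\<close> and hence the least concave majorant.\<close>

definition least_concave_majorant :: "(real \<Rightarrow> real) \<Rightarrow> real \<Rightarrow> real" where
  "least_concave_majorant K t =
     Inf {h t | h. concave_on {0..1} h \<and> (\<forall>s\<in>{0..1}. K s \<le> h s)}"

text \<open>The quotient is taken in the extended reals, where \<open>x / 0 = \<infinity>\<close> for \<open>x > 0\<close>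
  and \<open>0 / 0 = 0\<close>. With real division, where \<open>x / 0 = 0\<close>, every \<open>t\<close> below the
  smallest p-value would wrongly satisfy the constraint.\<close>

definition threshold :: "real \<Rightarrow> real \<Rightarrow> (real \<Rightarrow> real) \<Rightarrow> real" where
  "threshold \<alpha> b K =
     Sup {t \<in> {0..1}. ereal ((1 - b) * t) / ereal (K t) \<le> ereal \<alpha>}"

definition fdp :: "nat \<Rightarrow> (nat \<Rightarrow> real) \<Rightarrow> (nat \<Rightarrow> bool) \<Rightarrow> real \<Rightarrow> real" where
  "fdp m p h t =
     (\<Sum>i=1..m. of_bool (p i \<le> t) * (1 - of_bool (h i))) /
     ((\<Sum>i=1..m. of_bool (p i \<le> t)) + of_bool (\<forall>i\<in>{1..m}. t < p i))"

text \<open>An estimator based on \<open>m\<close> p-values, as a function of the vector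
  \<open>(p\<^sub>1, \<dots>, p\<^sub>m)\<close>.\<close>

definition is_estimator :: "nat \<Rightarrow> ((nat \<Rightarrow> real) \<Rightarrow> real) \<Rightarrow> bool" where
  "is_estimator m e \<longleftrightarrow>
     e \<in> Pi\<^sub>M {1..m} (\<lambda>_. borel) \<rightarrow>\<^sub>M restrict_space borel {0..1}"

text \<open>Convergence in probability to a constant; the \<open>m\<close>-th variable lives on its own
  probability space \<open>M m\<close>.\<close>

definition converges_in_prob ::
  "(nat \<Rightarrow> 'a measure) \<Rightarrow> (nat \<Rightarrow> 'a \<Rightarrow> real) \<Rightarrow> real \<Rightarrow> bool" where
  "converges_in_prob M X c \<longleftrightarrow>
     (\<forall>\<epsilon>>0. (\<lambda>m. measure (M m) {\<omega> \<in> space (M m). \<epsilon> < \<bar>X m \<omega> - c\<bar>}) \<longlonglongrightarrow> 0)"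

end

theory Submission
  imports Defs
begin

text \<open>
  Write \<open>R t\<close> for the number of p-values at most \<open>t\<close>, \<open>V t\<close> for the number of null ones among
  them, and \<open>G\<close> for the marginal distribution function. Given the p-values, the null labels are
  independent, and the label at \<open>x\<close> is null with probability \<open>(1 - a) / g x\<close>. Since \<open>G\<close> is
  concave, this local false discovery rate does not decrease in \<open>x\<close>, and since the threshold \<open>T\<close> is a
  function of the p-values alone, \<open>E \<Gamma>(T)\<close> is the expected average of the local rate over
  the rejected p-values. On \<open>T \<le> \<epsilon>\<close> it is therefore at most the local rate at \<open>\<epsilon>\<close> times the
  probability of rejecting anything (\<open>expectation_fdp_le_rejection_prob\<close>), however the estimator
  depends on the data. For the least concave majorant, an infimum over uncountably many functions,
  the measurability of \<open>T\<close> takes an argument: rational lines and rational points suffice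
  (\<open>least_concave_majorant_less_iff\<close>, \<open>threshold_majorant_greater_iff\<close>).

  Fix \<open>b\<close> with \<open>a0 < b < a\<close>. Outside an event of vanishing probability, \<open>ahat < b\<close>, and \<open>R / m\<close>
  and \<open>V / m\<close> are uniformly close to \<open>G t\<close> and \<open>(1 - a) t\<close> (\<open>uniform_deviation\<close>). Two cases
  remain, according to the slope of \<open>G\<close> at the origin.

  If \<open>\<alpha> G t > (1 - a) t\<close> for some \<open>t\<close>, the local rate is at most \<open>\<alpha>\<close> on some \<open>(0, \<epsilon>]\<close>, which
  settles the event \<open>T \<le> \<epsilon>\<close>. On \<open>T > \<epsilon>\<close> the threshold inequality gives
  \<open>(1 - b) T \<le> \<alpha> R T / m\<close> up to a small error, whereas \<open>V T / m\<close> is close to \<open>(1 - a) T\<close>; the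
  gap \<open>(a - b) T\<close> absorbs the errors, and \<open>V T \<le> \<alpha> R T\<close>
  (\<open>expectation_fdp_le_density_large\<close>).

  If \<open>\<alpha> G t \<le> (1 - a) t\<close> for all \<open>t\<close>, then \<open>T\<close> tends to \<open>0\<close>, and a law of large
  numbers need not hold at the scale of \<open>T\<close>. A rejection, however, forces the empirical distribution function to
  reach the line of slope \<open>(1 - b) / \<alpha>\<close> through the origin, also when the threshold is computed
  from the least concave majorant (\<open>crossing_if_rejection\<close>). This event no longer involves the
  estimator. With \<open>g0 = sup G t / t\<close>, its probability is at most \<open>g0 \<alpha> / (1 - b)\<close> by the
  leave-one-out argument of Benjamini and Hochberg (\<open>crossing_prob_le\<close>). The local rate near \<open>0\<close> is
  close to \<open>(1 - a) / g0\<close>, and the product \<open>(1 - a) / (1 - b) \<alpha>\<close> lies strictly below \<open>\<alpha>\<close>,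
  which leaves room for the approximation (\<open>expectation_fdp_le_density_small\<close>).
\<close>

text \<open>Sums over p-values range over \<open>{1..m}\<close>; the numeral is kept so that the simplifier does not
  rewrite this index set to \<open>{Suc 0..m}\<close>.\<close>

declare One_nat_def [simp del]

section \<open>Counts of p-values and their least concave majorant\<close>

definition num_le :: "nat \<Rightarrow> (nat \<Rightarrow> real) \<Rightarrow> real \<Rightarrow> nat" where
  "num_le m p t = card {i \<in> {1..m}. p i \<le> t}"

lemma empirical_cdf_num_le: "empirical_cdf m p t = real (num_le m p t) / real m"
  by (simp add: empirical_cdf_def num_le_def)

lemma num_le_mono: "s \<le> t \<Longrightarrow> num_le m p s \<le> num_le m p t"
  unfolding num_le_def by (intro card_mono) auto

lemma num_le_bound: "num_le m p t \<le> m"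
proof -
  have "card {i \<in> {1..m}. p i \<le> t} \<le> card {1..m}" by (intro card_mono) auto
  then show ?thesis by (simp add: num_le_def)
qed

lemma num_le_sum: "real (num_le m p t) = (\<Sum>i=1..m. of_bool (p i \<le> t))"
  by (simp add: num_le_def sum.If_cases of_bool_def Int_def conj_commute)

lemma num_le_measurable [measurable]:
  assumes [measurable]: "\<tau> \<in> borel_measurable (Pi\<^sub>M {1..m} (\<lambda>_. borel))"
  shows "(\<lambda>p. real (num_le m p (\<tau> p))) \<in> borel_measurable (Pi\<^sub>M {1..m} (\<lambda>_. borel))"
  unfolding num_le_sum of_bool_def by measurable

lemma mono_empirical_cdf: "mono (empirical_cdf m p)"
  unfolding empirical_cdf_num_le by (intro monoI divide_right_mono) (auto intro: num_le_mono)

lemma empirical_cdf_range: "0 \<le> empirical_cdf m p t" "empirical_cdf m p t \<le> 1"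
  using num_le_bound[of m p t] by (auto simp: empirical_cdf_num_le divide_le_eq_1)

lemma least_concave_majorant_le:
  assumes "concave_on {0..1} h" "\<forall>s\<in>{0..1}. K s \<le> h s" "t \<in> {0..1}"
  shows "least_concave_majorant K t \<le> h t"
  unfolding least_concave_majorant_def
proof (rule cInf_lower)
  show "bdd_below {h t |h. concave_on {0..1} h \<and> (\<forall>s\<in>{0..1}. K s \<le> h s)}"
    using assms(3) by (intro bdd_belowI[of _ "K t"]) auto
qed (use assms in blast)

lemma least_concave_majorant_greatest:
  assumes "\<And>h. concave_on {0..1} h \<Longrightarrow> (\<forall>s\<in>{0..1}. K s \<le> h s) \<Longrightarrow> y \<le> h t"
    and bounded: "\<forall>s\<in>{0..1}. K s \<le> c"
  shows "y \<le> least_concave_majorant K t"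
  unfolding least_concave_majorant_def
proof (rule cInf_greatest)
  have "concave_on {0..1} (\<lambda>_::real. c)" by (simp add: concave_on_const)
  then show "{h t |h. concave_on {0..1} h \<and> (\<forall>s\<in>{0..1}. K s \<le> h s)} \<noteq> {}"
    using bounded by blast
qed (use assms(1) in blast)

lemma least_concave_majorant_ge:
  assumes "\<forall>s\<in>{0..1}. K s \<le> c" "t \<in> {0..1}"
  shows "K t \<le> least_concave_majorant K t"
  by (rule least_concave_majorant_greatest[of K _ _ c]) (use assms in auto)

text \<open>Between the origin and \<open>t\<close>, a concave function lies above its chord. Hence the set of points
  satisfying the threshold inequality is an interval, which is what reduces the threshold of a
  majorant to rational test points.\<close>

lemma least_concave_majorant_star:
  assumes nonneg: "0 \<le> K 0" and bounded: "\<forall>s\<in>{0..1}. K s \<le> c"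
    and "0 \<le> s" "s \<le> t" "0 < t" "t \<le> 1"
  shows "s / t * least_concave_majorant K t \<le> least_concave_majorant K s"
proof (rule least_concave_majorant_greatest[of K _ _ c])
  fix h assume h: "concave_on {0..1} h" "\<forall>s\<in>{0..1}. K s \<le> h s"
  have "s / t * least_concave_majorant K t \<le> s / t * h t"
    using assms least_concave_majorant_le[OF h, of t] by (intro mult_left_mono) auto
  also have "\<dots> \<le> (1 - s / t) * h 0 + s / t * h t"
    using nonneg bspec[OF h(2), of 0] assms by auto
  also have "\<dots> \<le> h ((1 - s / t) *\<^sub>R 0 + (s / t) *\<^sub>R t)"
    by (rule concave_onD[OF h(1)]) (use assms in auto)
  also have "\<dots> = h s" using assms by simp
  finally show "s / t * least_concave_majorant K t \<le> h s" .
qed (use bounded in auto)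

lemma concave_on_affine: "concave_on {0..1} (\<lambda>s::real. c + l * s)"
  by (intro concave_on_add) (simp_all add: concave_on_const, simp add: concave_on_iff algebra_simps)

text \<open>A monotone function that exceeded the line at \<open>s\<close> would exceed it immediately to the right of \<open>s\<close>
  as well. The point \<open>1\<close> is itself rational.\<close>

lemma majorant_from_rationals:
  assumes "mono K" "\<forall>s\<in>{0..1} \<inter> \<rat>. K s \<le> c + l * s" "s \<in> {0..1::real}"
  shows "K s \<le> c + l * s"
proof (rule ccontr)
  assume neg: "\<not> K s \<le> c + l * s"
  then have "s \<noteq> 1" using assms(2) by auto
  with assms have s: "0 \<le> s" "s < 1" by auto
  have "((\<lambda>x. c + l * x) \<longlongrightarrow> c + l * s) (at_right s)"
    by (intro tendsto_intros)
  with neg have "\<forall>\<^sub>F x in at_right s. c + l * x < K s"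
    by (intro order_tendstoD(2)) auto
  then obtain d where d: "d > s" "\<And>x. s < x \<Longrightarrow> x < d \<Longrightarrow> c + l * x < K s"
    unfolding eventually_at_right_field by blast
  obtain x where x: "x \<in> \<rat>" "s < x" "x < min d 1"
    using Rats_dense_in_real[of s "min d 1"] d s by auto
  have "x \<in> {0..1} \<inter> \<rat>" using x s by simp
  then have "K x \<le> c + l * x" using assms(2) by blast
  moreover have "c + l * x < K s" by (rule d(2)) (use x in simp_all)
  moreover have "K s \<le> K x" by (rule monoD[OF \<open>mono K\<close>]) (use x in simp)
  ultimately show False by simp
qed

text \<open>At an interior point a concave majorant may be replaced by a supporting line, whose intercept
  and slope may then be increased slightly to rational values. This writes the value of the majorant
  as an infimum over countably many lines and so makes it measurable in the p-values.\<close>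

lemma least_concave_majorant_less_iff:
  assumes "mono K" and bounded: "\<forall>s\<in>{0..1}. K s \<le> B" and t: "0 < t" "t < 1"
  shows "least_concave_majorant K t < y \<longleftrightarrow>
    (\<exists>c\<in>\<rat>. \<exists>l\<in>\<rat>. (\<forall>s\<in>{0..1} \<inter> \<rat>. K s \<le> c + l * s) \<and> c + l * t < y)"
proof
  assume "least_concave_majorant K t < y"
  then have "\<not> y \<le> least_concave_majorant K t" by simp
  then have "\<not> (\<forall>h. concave_on {0..1} h \<longrightarrow> (\<forall>s\<in>{0..1}. K s \<le> h s) \<longrightarrow> y \<le> h t)"
    using least_concave_majorant_greatest[of K y t B] bounded by blast
  then obtain h where h: "concave_on {0..1} h" "\<forall>s\<in>{0..1}. K s \<le> h s" "h t < y"
    by auto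
  obtain k where k: "\<forall>s\<in>{0..1}. h s \<le> h t + k * (s - t)"
  proof -
    have "- h t + Inf ((\<lambda>x. (- h t - - h x) / (t - x)) ` ({t<..} \<inter> {0..1})) * (s - t) \<le> - h s"
      if "s \<in> {0..1}" for s
      using convex_le_Inf_differential[of "{0..1}" "\<lambda>x. - h x" t s] h(1) t that
      by (auto simp: concave_on_def)
    then show ?thesis
      by (intro that[of "- Inf ((\<lambda>x. (- h t - - h x) / (t - x)) ` ({t<..} \<inter> {0..1}))"])
         (simp add: algebra_simps)
  qed
  define e where "e = (y - h t) / 2"
  have e: "e > 0" using h(3) by (simp add: e_def)
  obtain l where l: "l \<in> \<rat>" "k < l" "l < k + e" using Rats_dense_in_real[of k "k + e"] e by auto
  obtain c where c: "c \<in> \<rat>" "h t - k * t < c" "c < h t - k * t + e"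
    using Rats_dense_in_real[of "h t - k * t" "h t - k * t + e"] e by auto
  have "K s \<le> c + l * s" if "s \<in> {0..1}" for s
  proof -
    have "k * s \<le> l * s" using l that by (intro mult_right_mono) auto
    then show ?thesis using h(2)[rule_format, OF that] k[rule_format, OF that] c by (simp add: algebra_simps)
  qed
  moreover have "c + l * t < y"
  proof -
    have "(l - k) * t \<le> e * 1" using l t e by (intro mult_mono) auto
    then show ?thesis using c unfolding e_def by (simp add: field_simps)
  qed
  ultimately show "\<exists>c\<in>\<rat>. \<exists>l\<in>\<rat>. (\<forall>s\<in>{0..1} \<inter> \<rat>. K s \<le> c + l * s) \<and> c + l * t < y"
    using l(1) c(1) by blast
next
  assume "\<exists>c\<in>\<rat>. \<exists>l\<in>\<rat>. (\<forall>s\<in>{0..1} \<inter> \<rat>. K s \<le> c + l * s) \<and> c + l * t < y"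
  then obtain c l where cl: "\<forall>s\<in>{0..1} \<inter> \<rat>. K s \<le> c + l * s" "c + l * t < y" by blast
  have "\<forall>s\<in>{0..1}. K s \<le> c + l * s"
    using majorant_from_rationals[OF \<open>mono K\<close> cl(1)] by blast
  moreover have "t \<in> {0..1}" using t by simp
  ultimately have "least_concave_majorant K t \<le> c + l * t"
    by (rule least_concave_majorant_le[OF concave_on_affine])
  with cl(2) show "least_concave_majorant K t < y" by linarith
qed

section \<open>Thresholds and their measurability\<close>

lemma threshold_eq:
  assumes "0 < \<alpha>" "b \<le> 1" "\<forall>t\<in>{0..1}. 0 \<le> K t"
  shows "threshold \<alpha> b K = Sup {t \<in> {0..1}. (1 - b) * t \<le> \<alpha> * K t}"
proof -
  have "ereal ((1 - b) * t) / ereal (K t) \<le> ereal \<alpha> \<longleftrightarrow> (1 - b) * t \<le> \<alpha> * K t"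
    if t: "t \<in> {0..1}" for t
  proof (cases "K t = 0")
    case True
    have "0 \<le> (1 - b) * t" using assms t by simp
    then consider "(1 - b) * t = 0" | "0 < (1 - b) * t" by linarith
    then show ?thesis
    proof cases
      case 1 then show ?thesis using assms(1) unfolding 1 True by simp
    next
      case 2
      have *: "ereal x / ereal 0 = \<infinity>" if "0 < x" for x
        using that by (simp add: divide_ereal_def)
      show ?thesis unfolding True *[OF 2] using 2 by simp
    qed
  next
    case False
    then have "0 < K t" using bspec[OF assms(3) t] by simp
    then show ?thesis by (simp add: field_simps)
  qed
  then have "{t \<in> {0..1}. ereal ((1 - b) * t) / ereal (K t) \<le> ereal \<alpha>}
      = {t \<in> {0..1}. (1 - b) * t \<le> \<alpha> * K t}" by (intro Collect_cong conj_cong refl)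
  then show ?thesis by (simp only: threshold_def)
qed

lemma threshold_set:
  fixes \<alpha> b :: real and K :: "real \<Rightarrow> real"
  assumes "0 < \<alpha>" "\<forall>t\<in>{0..1}. 0 \<le> K t"
  defines "S \<equiv> {t \<in> {0..1}. (1 - b) * t \<le> \<alpha> * K t}"
  shows "0 \<in> S" "S \<noteq> {}" "bdd_above S"
proof -
  show "0 \<in> S" using assms by simp
  then show "S \<noteq> {}" by auto
  show "bdd_above S" by (rule bdd_aboveI[of _ 1]) (auto simp: S_def)
qed

text \<open>The inequality defining the threshold may fail at the supremum itself when \<open>K\<close> is not
  upper semicontinuous there. It survives for a continuous majorant, where the set of
  solutions is closed.\<close>

lemma threshold_le_majorant:
  assumes "0 < \<alpha>" "b \<le> 1" "\<forall>t\<in>{0..1}. 0 \<le> K t"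
    and L: "continuous_on {0..1} L" "\<forall>t\<in>{0..1}. K t \<le> L t"
  defines "T \<equiv> threshold \<alpha> b K"
  shows "(1 - b) * T \<le> \<alpha> * L T"
proof -
  let ?S = "{t \<in> {0..1}. (1 - b) * t \<le> \<alpha> * K t}"
  let ?C = "{t \<in> {0..1}. (1 - b) * t \<le> \<alpha> * L t}"
  have "?S \<subseteq> ?C"
    using L(2) \<open>0 < \<alpha>\<close> by (auto intro: order_trans mult_left_mono)
  moreover have "closed ?C"
    by (intro continuous_on_closed_Collect_le continuous_intros L(1) closed_atLeastAtMost)
  moreover have "Sup ?S \<in> closure ?S"
    using threshold_set[where K = K and b = b, OF assms(1,3)] by (intro closure_contains_Sup) auto
  ultimately have "Sup ?S \<in> ?C" using closure_minimal by blast
  then show ?thesis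
    unfolding T_def threshold_eq[where K = K, OF assms(1-3)] by simp
qed

lemma threshold_greater_iff:
  assumes "0 < \<alpha>" "b \<le> 1" "\<forall>t\<in>{0..1}. 0 \<le> K t"
  shows "s < threshold \<alpha> b K \<longleftrightarrow> (\<exists>t\<in>{0..1}. s < t \<and> (1 - b) * t \<le> \<alpha> * K t)"
  using threshold_set[where K = K and b = b, OF assms(1,3)]
  by (subst threshold_eq[where K = K, OF assms]) (auto simp: less_cSup_iff)

lemma threshold_range:
  assumes "0 < \<alpha>" "b \<le> 1" "\<forall>t\<in>{0..1}. 0 \<le> K t"
  shows "0 \<le> threshold \<alpha> b K" "threshold \<alpha> b K \<le> 1"
proof -
  note greater = threshold_greater_iff[where K = K, OF assms]
  have "0 \<le> \<alpha> * K 0" using assms(1) assms(3) by simp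
  then have "\<not> threshold \<alpha> b K < 0"
    using greater[of "threshold \<alpha> b K"] by force
  then show "0 \<le> threshold \<alpha> b K" by simp
  have "\<not> 1 < threshold \<alpha> b K" unfolding greater by auto
  then show "threshold \<alpha> b K \<le> 1" by simp
qed

text \<open>With \<open>k = R t\<close>, a feasible \<open>t\<close> is at most \<open>c k\<close>, the largest point at which \<open>k\<close> rejections
  suffice, and \<open>c k\<close> is feasible too. Hence the threshold is the maximum of finitely many explicit
  candidates.\<close>

lemma threshold_empirical_greater_iff:
  fixes \<alpha> b :: real
  assumes "0 < \<alpha>" "b \<le> 1" "m \<ge> 1"
  defines "c \<equiv> \<lambda>k. if (1 - b) * m \<le> \<alpha> * real k then 1 else \<alpha> * k / ((1 - b) * m)"
  shows "s < threshold \<alpha> b (empirical_cdf m p) \<longleftrightarrow>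
    (\<exists>k\<in>{..m}. s < c k \<and> real k \<le> real (num_le m p (c k)))"
proof -
  have nonneg: "\<forall>t\<in>{0..1}. 0 \<le> empirical_cdf m p t" by (simp add: empirical_cdf_range)
  have c: "c k \<in> {0..1}" "(1 - b) * c k \<le> \<alpha> * (real k / m)" for k
  proof -
    have "c k \<in> {0..1} \<and> (1 - b) * c k \<le> \<alpha> * (real k / m)"
    proof (cases "(1 - b) * m \<le> \<alpha> * real k")
      case True
      then show ?thesis using \<open>m \<ge> 1\<close> by (simp add: c_def field_simps)
    next
      case False
      moreover have "0 \<le> \<alpha> * real k" using \<open>0 < \<alpha>\<close> by simp
      ultimately have "0 < (1 - b) * m" "\<alpha> * real k \<le> (1 - b) * m" by linarith+
      moreover from this have "1 - b \<noteq> 0" by auto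
      ultimately show ?thesis using \<open>m \<ge> 1\<close> \<open>0 < \<alpha>\<close> False
        by (simp add: c_def divide_le_eq_1 del: zero_less_mult_iff)
    qed
    then show "c k \<in> {0..1}" "(1 - b) * c k \<le> \<alpha> * (real k / m)" by auto
  qed
  have c_greatest: "t \<le> c k" if "t \<in> {0..1}" "(1 - b) * t \<le> \<alpha> * (real k / m)" for t k
  proof (cases "(1 - b) * m \<le> \<alpha> * real k")
    case False
    moreover have "0 \<le> \<alpha> * real k" using \<open>0 < \<alpha>\<close> by simp
    ultimately have "0 < (1 - b) * m" by linarith
    moreover have "(1 - b) * t * m \<le> \<alpha> * real k" using that \<open>m \<ge> 1\<close> by (simp add: field_simps)
    ultimately show ?thesis using False by (simp add: c_def pos_le_divide_eq mult_ac)
  qed (use that in \<open>simp add: c_def\<close>)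
  show ?thesis
    unfolding threshold_greater_iff[where K = "empirical_cdf m p", OF assms(1,2) nonneg]
  proof safe
    fix t assume t: "t \<in> {0..1}" "s < t" "(1 - b) * t \<le> \<alpha> * empirical_cdf m p t"
    let ?k = "num_le m p t"
    have "t \<le> c ?k" using c_greatest[of t ?k] t by (simp add: empirical_cdf_num_le)
    then show "\<exists>k\<in>{..m}. s < c k \<and> real k \<le> real (num_le m p (c k))"
      using t num_le_bound[of m p t] by (intro bexI[of _ ?k]) (auto intro: num_le_mono)
  next
    fix k assume k: "k \<le> m" "s < c k" "real k \<le> real (num_le m p (c k))"
    have "\<alpha> * (real k / m) \<le> \<alpha> * empirical_cdf m p (c k)"
      unfolding empirical_cdf_num_le
      using k assms by (intro mult_left_mono divide_right_mono) auto
    then show "\<exists>t\<in>{0..1}. s < t \<and> (1 - b) * t \<le> \<alpha> * empirical_cdf m p t"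
      using c[of k] k by (intro bexI[of _ "c k"]) auto
  qed
qed

lemma measurable_threshold_empirical:
  fixes e :: "(nat \<Rightarrow> real) \<Rightarrow> real"
  assumes "0 < \<alpha>" "m \<ge> 1" and e [measurable]: "e \<in> borel_measurable (Pi\<^sub>M {1..m} (\<lambda>_. borel))"
    and "\<And>p. p \<in> space (Pi\<^sub>M {1..m} (\<lambda>_. borel)) \<Longrightarrow> e p \<le> 1"
  shows "(\<lambda>p. threshold \<alpha> (e p) (empirical_cdf m p)) \<in> borel_measurable (Pi\<^sub>M {1..m} (\<lambda>_. borel))"
  unfolding borel_measurable_iff_greater
proof
  fix s
  let ?c = "\<lambda>p k. if (1 - e p) * m \<le> \<alpha> * real k then 1 else \<alpha> * k / ((1 - e p) * m)"
  have "{p \<in> space (Pi\<^sub>M {1..m} (\<lambda>_. borel)). s < threshold \<alpha> (e p) (empirical_cdf m p)} =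
    {p \<in> space (Pi\<^sub>M {1..m} (\<lambda>_. borel)). \<exists>k\<in>{..m}. s < ?c p k \<and> real k \<le> real (num_le m p (?c p k))}"
    using assms by (intro Collect_cong conj_cong refl threshold_empirical_greater_iff) auto
  also have "\<dots> \<in> sets (Pi\<^sub>M {1..m} (\<lambda>_. borel))" by measurable
  finally show "{p \<in> space (Pi\<^sub>M {1..m} (\<lambda>_. borel)). s < threshold \<alpha> (e p) (empirical_cdf m p)}
    \<in> sets (Pi\<^sub>M {1..m} (\<lambda>_. borel))" .
qed

lemma measurable_least_concave_majorant:
  assumes t: "0 < t" "t < 1"
  shows "(\<lambda>p. least_concave_majorant (empirical_cdf m p) t)
    \<in> borel_measurable (Pi\<^sub>M {1..m} (\<lambda>_. borel))"
  unfolding borel_measurable_iff_less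
proof
  fix y
  have [measurable]: "(\<lambda>p. empirical_cdf m p s) \<in> borel_measurable (Pi\<^sub>M {1..m} (\<lambda>_. borel))" for s
    unfolding empirical_cdf_num_le by measurable
  have "{p \<in> space (Pi\<^sub>M {1..m} (\<lambda>_. borel)). least_concave_majorant (empirical_cdf m p) t < y} =
    {p \<in> space (Pi\<^sub>M {1..m} (\<lambda>_. borel)). \<exists>c\<in>\<rat>. \<exists>l\<in>\<rat>.
      (\<forall>s\<in>{0..1} \<inter> \<rat>. empirical_cdf m p s \<le> c + l * s) \<and> c + l * t < y}"
    by (intro Collect_cong conj_cong refl least_concave_majorant_less_iff[of _ 1] mono_empirical_cdf t)
       (simp add: empirical_cdf_range)
  also have "\<dots> \<in> sets (Pi\<^sub>M {1..m} (\<lambda>_. borel))"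
  proof -
    have *: "{p \<in> space (Pi\<^sub>M {1..m} (\<lambda>_. borel)). empirical_cdf m p s \<le> c + l * s}
      \<in> sets (Pi\<^sub>M {1..m} (\<lambda>_. borel))" for s c l by measurable
    have "{p \<in> space (Pi\<^sub>M {1..m} (\<lambda>_. borel)). \<forall>s\<in>{0..1} \<inter> \<rat>. empirical_cdf m p s \<le> c + l * s}
      \<in> sets (Pi\<^sub>M {1..m} (\<lambda>_. borel))" for c l
      by (rule sets.sets_Collect_countable_All'[OF *]) (rule countable_Int2, rule countable_rat)
    then show ?thesis
      by (intro sets.sets_Collect_countable_Ex'[OF _ countable_rat] sets.sets_Collect_conj) simp_all
  qed
  finally show "{p \<in> space (Pi\<^sub>M {1..m} (\<lambda>_. borel)). least_concave_majorant (empirical_cdf m p) t < y}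
    \<in> sets (Pi\<^sub>M {1..m} (\<lambda>_. borel))" .
qed

lemma threshold_majorant_greater_iff:
  assumes "0 < \<alpha>" "b \<le> 1" "0 \<le> s" and K: "\<forall>t\<in>{0..1}. K t \<in> {0..B}"
  shows "s < threshold \<alpha> b (least_concave_majorant K) \<longleftrightarrow>
    (\<exists>t\<in>\<rat>. s < t \<and> t < 1 \<and> (1 - b) * t \<le> \<alpha> * least_concave_majorant K t)"
proof -
  let ?C = "least_concave_majorant K"
  have bounds: "0 \<le> K 0" "\<forall>t\<in>{0..1}. K t \<le> B" using K by auto
  have nonneg: "\<forall>t\<in>{0..1}. 0 \<le> ?C t"
  proof
    fix t :: real assume t: "t \<in> {0..1}"
    have "0 \<le> K t" using bspec[OF K t] by simp
    also have "\<dots> \<le> ?C t" by (rule least_concave_majorant_ge[OF bounds(2) t])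
    finally show "0 \<le> ?C t" .
  qed
  show ?thesis
    unfolding threshold_greater_iff[where K = ?C, OF assms(1,2) nonneg]
  proof safe
    fix t :: real assume t: "t \<in> {0..1}" "s < t" "(1 - b) * t \<le> \<alpha> * ?C t"
    obtain r where r: "r \<in> \<rat>" "s < r" "r < t" using Rats_dense_in_real[OF t(2)] by auto
    have "(1 - b) * r = r / t * ((1 - b) * t)" using r t \<open>0 \<le> s\<close> by simp
    also have "\<dots> \<le> r / t * (\<alpha> * ?C t)" using r t \<open>0 \<le> s\<close> by (intro mult_left_mono) auto
    also have "\<dots> = \<alpha> * (r / t * ?C t)" by simp
    also have "\<dots> \<le> \<alpha> * ?C r"
      using r t \<open>0 \<le> s\<close> \<open>0 < \<alpha>\<close> bounds
      by (intro mult_left_mono least_concave_majorant_star[of K B]) auto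
    finally show "\<exists>t\<in>\<rat>. s < t \<and> t < 1 \<and> (1 - b) * t \<le> \<alpha> * ?C t"
      using r t by (intro bexI[of _ r]) auto
  next
    fix t assume "t \<in> \<rat>" "s < t" "t < 1" "(1 - b) * t \<le> \<alpha> * ?C t"
    then show "\<exists>t\<in>{0..1}. s < t \<and> (1 - b) * t \<le> \<alpha> * ?C t"
      using \<open>0 \<le> s\<close> by (intro bexI[of _ t]) auto
  qed
qed

lemma measurable_threshold_majorant:
  fixes e :: "(nat \<Rightarrow> real) \<Rightarrow> real"
  assumes "0 < \<alpha>" and e [measurable]: "e \<in> borel_measurable (Pi\<^sub>M {1..m} (\<lambda>_. borel))"
    and e_le: "\<And>p. p \<in> space (Pi\<^sub>M {1..m} (\<lambda>_. borel)) \<Longrightarrow> e p \<le> 1"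
  shows "(\<lambda>p. threshold \<alpha> (e p) (least_concave_majorant (empirical_cdf m p)))
    \<in> borel_measurable (Pi\<^sub>M {1..m} (\<lambda>_. borel))"
  unfolding borel_measurable_iff_greater
proof
  fix s
  let ?M = "Pi\<^sub>M {1..m} (\<lambda>_. borel) :: (nat \<Rightarrow> real) measure"
  let ?C = "\<lambda>p. least_concave_majorant (empirical_cdf m p)"
  let ?S = "{p \<in> space ?M. s < threshold \<alpha> (e p) (?C p)}"
  have C_nonneg: "threshold \<alpha> (e p) (?C p) \<ge> 0" if "p \<in> space ?M" for p
  proof -
    have "\<forall>t\<in>{0..1}. 0 \<le> ?C p t"
      using empirical_cdf_range[of m p]
      by (intro ballI order_trans[OF _ least_concave_majorant_ge[of _ 1]]) auto
    then show ?thesis by (intro threshold_range(1)[OF \<open>0 < \<alpha>\<close> e_le[OF that]])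
  qed
  show "?S \<in> sets ?M"
  proof (cases "0 \<le> s")
    case True
    have "?S = {p \<in> space ?M. \<exists>t\<in>\<rat>. s < t \<and> t < 1 \<and> (1 - e p) * t \<le> \<alpha> * ?C p t}"
      using \<open>0 < \<alpha>\<close> e_le True
      by (intro Collect_cong conj_cong refl threshold_majorant_greater_iff[where B = 1])
         (simp_all add: empirical_cdf_range)
    also have "\<dots> \<in> sets ?M"
    proof (intro sets.sets_Collect_countable_Ex' countable_rat)
      fix t :: real
      show "{p \<in> space ?M. s < t \<and> t < 1 \<and> (1 - e p) * t \<le> \<alpha> * ?C p t} \<in> sets ?M"
      proof (cases "s < t \<and> t < 1")
        case t: True
        have C: "(\<lambda>p. ?C p t) \<in> borel_measurable ?M"
          by (rule measurable_least_concave_majorant) (use True t in linarith)+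
        have "{p \<in> space ?M. (1 - e p) * t \<le> \<alpha> * ?C p t} \<in> sets ?M"
          by (intro borel_measurable_le borel_measurable_times borel_measurable_diff
              borel_measurable_const C e)
        then show ?thesis by (simp only: t simp_thms)
      next
        case False
        then have "{p \<in> space ?M. s < t \<and> t < 1 \<and> (1 - e p) * t \<le> \<alpha> * ?C p t} = {}" by blast
        then show ?thesis by (simp only: sets.empty_sets)
      qed
    qed
    finally show ?thesis .
  next
    case False
    then have "s < threshold \<alpha> (e p) (?C p)" if "p \<in> space ?M" for p
      using C_nonneg[OF that] by linarith
    then have "?S = space ?M" by blast
    then show ?thesis by (simp only: sets.top)
  qed
qed

section \<open>The marginal law and the null mass near the origin\<close>

context two_groups
begin

abbreviation G :: "real \<Rightarrow> real" where "G \<equiv> mixture_cdf a F"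

lemma mixture_cdf_integral:
  assumes "t \<in> {0..1}"
  shows "G t = integral {0..t} g"
proof -
  have "set_integrable lborel {0..t} g"
    using set_integrable_subset[OF g_integrable, of "{0..t}"] assms by auto
  then show ?thesis by (simp add: g_density[OF assms] set_borel_integral_eq_integral(2))
qed

lemma mixture_cdf_0: "G 0 = 0"
  by (simp add: mixture_cdf_integral)

lemma mixture_cdf_1: "G 1 = 1"
  using F_cdf by (simp add: mixture_cdf_def is_cdf_unit_def)

lemma mixture_cdf_mono: "s \<le> t \<Longrightarrow> G s \<le> G t"
  using F_cdf a_nonneg a_le_1 unfolding mixture_cdf_def is_cdf_unit_def
  by (intro add_mono mult_left_mono) (auto dest: monoD)

lemma continuous_on_mixture_cdf: "continuous_on {0..1} G"
proof (rule continuous_on_eq)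
  show "continuous_on {0..1} (\<lambda>t. integral {0..t} g)"
    by (intro indefinite_integral_continuous_1 set_borel_integral_eq_integral g_integrable)
qed (simp add: mixture_cdf_integral)

text \<open>At a point of differentiability, a concave function lies below its tangent.\<close>

lemma density_above_tangent:
  assumes concave: "concave_on {0..1} G" and t: "0 < t" "t \<le> 1"
  shows "AE x in lborel. 0 < x \<and> x < t \<longrightarrow> G t - G x \<le> g x * (t - x)"
  using g_deriv
proof eventually_elim
  case (elim x)
  show ?case
  proof
    assume x: "0 < x \<and> x < t"
    have "((\<lambda>x. - G x) has_real_derivative - g x) (at x within {0..1})"
      using elim x t by (auto intro!: derivative_intros intro: has_field_derivative_at_within)
    with concave x t have "- g x * (t - x) \<le> - G t - - G x"
      by (intro convex_on_imp_above_tangent[of "{0..1}" "\<lambda>x. - G x"]) (auto simp: concave_on_def)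
    then show "G t - G x \<le> g x * (t - x)" by simp
  qed
qed

lemma g_nonneg:
  assumes "concave_on {0..1} G"
  shows "AE x in lborel. x \<in> {0<..<1} \<longrightarrow> 0 \<le> g x"
  using density_above_tangent[OF assms, of 1, simplified]
proof eventually_elim
  case (elim x)
  show ?case
  proof
    assume x: "x \<in> {0<..<1}"
    with elim mixture_cdf_mono[of x 1] have "0 \<le> g x * (1 - x)" by auto
    with x show "0 \<le> g x" by (simp add: zero_le_mult_iff)
  qed
qed

text \<open>The chord of \<open>G\<close> from \<open>x\<close> to \<open>t\<close> has slope above \<open>\<gamma>\<close> once \<open>G x\<close> is small, which holds near
  the origin by continuity; the tangent slope at \<open>x\<close> is at least as large.\<close>

lemma density_ge_near_0:
  assumes concave: "concave_on {0..1} G" and t: "0 < t" "t \<le> 1"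
    and \<gamma>: "0 \<le> \<gamma>" "\<gamma> * t < G t"
  obtains \<epsilon> where "0 < \<epsilon>" "\<epsilon> < 1" "AE x in lborel. x \<in> {0<..\<epsilon>} \<longrightarrow> \<gamma> \<le> g x"
proof -
  have "(G \<longlongrightarrow> 0) (at 0 within {0..1})"
    using continuous_on_mixture_cdf mixture_cdf_0 by (auto simp: continuous_on_def dest!: bspec[of _ _ 0])
  then have "\<forall>\<^sub>F x in at 0 within {0..1}. G x < G t - \<gamma> * t"
    using \<gamma> by (intro order_tendstoD(2)) auto
  then obtain d where d: "d > 0" "\<And>x. x \<in> {0..1} \<Longrightarrow> x \<noteq> 0 \<Longrightarrow> dist x 0 < d \<Longrightarrow> G x < G t - \<gamma> * t"
    unfolding eventually_at by blast
  define \<epsilon> where "\<epsilon> = min d t / 2"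
  have \<epsilon>: "0 < \<epsilon>" "\<epsilon> < t" "\<epsilon> < d" using d t by (auto simp: \<epsilon>_def)
  have "AE x in lborel. x \<in> {0<..\<epsilon>} \<longrightarrow> \<gamma> \<le> g x"
    using density_above_tangent[OF concave t]
  proof eventually_elim
    case (elim x)
    show ?case
    proof
      assume x: "x \<in> {0<..\<epsilon>}"
      with \<epsilon> t have "G x < G t - \<gamma> * t" by (intro d(2)) auto
      moreover have "G t - G x \<le> g x * (t - x)" using elim x \<epsilon> by auto
      moreover have "\<gamma> * (t - x) \<le> \<gamma> * t" using \<gamma> x by (intro mult_left_mono) auto
      ultimately have "\<gamma> * (t - x) \<le> g x * (t - x)" by linarith
      moreover have "0 < t - x" using x \<epsilon> by simp
      ultimately show "\<gamma> \<le> g x" by (simp add: mult_le_cancel_right)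
    qed
  qed
  then show thesis using \<epsilon> t by (intro that[of \<epsilon>]) auto
qed

end

context two_groups_sample
begin

lemma pair_measurable:
  "i \<in> {1..m} \<Longrightarrow> (\<lambda>\<omega>. (P i \<omega>, H i \<omega>)) \<in> M \<rightarrow>\<^sub>M borel \<Otimes>\<^sub>M count_space UNIV"
  using indep_pairs by (auto simp: indep_vars_def)

lemma P_measurable [measurable]: "i \<in> {1..m} \<Longrightarrow> P i \<in> borel_measurable M"
  using measurable_compose[OF pair_measurable measurable_fst] by simp

lemma H_measurable [measurable]: "i \<in> {1..m} \<Longrightarrow> H i \<in> M \<rightarrow>\<^sub>M count_space UNIV"
  using measurable_compose[OF pair_measurable measurable_snd] by simp

lemma prob_alternative:
  assumes i [measurable]: "i \<in> {1..m}"
  shows "prob {\<omega> \<in> space M. H i \<omega>} = a"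
proof -
  have "a = measure (measure_pmf (bernoulli_pmf a)) {True}"
    using a_nonneg a_le_1 by (simp add: measure_pmf_single)
  also have "\<dots> = measure (distr M (count_space UNIV) (H i)) {True}" by (simp add: H_bernoulli[OF i])
  also have "\<dots> = prob (H i -` {True} \<inter> space M)" by (intro measure_distr H_measurable i) auto
  also have "H i -` {True} \<inter> space M = {\<omega> \<in> space M. H i \<omega>}" by auto
  finally show ?thesis by simp
qed

lemma prob_null:
  assumes i [measurable]: "i \<in> {1..m}"
  shows "prob {\<omega> \<in> space M. \<not> H i \<omega>} = 1 - a"
  using prob_neg[of "H i"] prob_alternative[OF i] by simp

text \<open>The null p-values have the sub-probability law with density \<open>1 - a\<close> on \<open>(0, 1)\<close>. For \<open>a = 1\<close>
  the conditioning event is null and both sides vanish.\<close>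

lemma nn_integral_null:
  assumes i [measurable]: "i \<in> {1..m}" and [measurable]: "\<psi> \<in> borel_measurable borel"
  shows "(\<integral>\<^sup>+\<omega>. \<psi> (P i \<omega>) * indicator {\<omega> \<in> space M. \<not> H i \<omega>} \<omega> \<partial>M)
    = ennreal (1 - a) * (\<integral>\<^sup>+x. \<psi> x * indicator {0<..<1} x \<partial>lborel)"
proof (cases "a < 1")
  case True
  let ?A = "{\<omega> \<in> space M. \<not> H i \<omega>}"
  have emeasure_A: "emeasure M ?A = ennreal (1 - a)"
    by (simp add: emeasure_eq_measure prob_null[OF i])
  have "(\<integral>\<^sup>+\<omega>. \<psi> (P i \<omega>) * indicator ?A \<omega> \<partial>M) / ennreal (1 - a)
      = (\<integral>\<^sup>+\<omega>. \<psi> (P i \<omega>) \<partial>uniform_measure M ?A)"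
    by (subst nn_integral_uniform_measure) (simp_all add: emeasure_A)
  also have "\<dots> = (\<integral>\<^sup>+x. \<psi> x \<partial>distr (uniform_measure M ?A) borel (P i))"
    by (subst nn_integral_distr) simp_all
  also have "\<dots> = (\<integral>\<^sup>+x. \<psi> x \<partial>uniform_measure lborel {0<..<1})"
    by (simp add: P_null[OF i True])
  also have "\<dots> = (\<integral>\<^sup>+x. \<psi> x * indicator {0<..<1} x \<partial>lborel)"
    by (subst nn_integral_uniform_measure) (simp_all add: divide_ennreal_def)
  finally have *: "(\<integral>\<^sup>+\<omega>. \<psi> (P i \<omega>) * indicator ?A \<omega> \<partial>M) / ennreal (1 - a)
      = (\<integral>\<^sup>+x. \<psi> x * indicator {0<..<1} x \<partial>lborel)" .
  show ?thesis
    unfolding *[symmetric] using True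
    by (simp add: ennreal_times_divide mult.commute[of "ennreal (1 - a)"] ennreal_mult_divide_eq)
next
  case False
  then have "a = 1" using a_le_1 by simp
  then have "emeasure M {\<omega> \<in> space M. \<not> H i \<omega>} = 0"
    by (simp add: emeasure_eq_measure prob_null[OF i])
  then have "AE \<omega> in M. H i \<omega>" by (intro AE_I[of _ _ "{\<omega> \<in> space M. \<not> H i \<omega>}"]) auto
  then have "(\<integral>\<^sup>+\<omega>. \<psi> (P i \<omega>) * indicator {\<omega> \<in> space M. \<not> H i \<omega>} \<omega> \<partial>M) = (\<integral>\<^sup>+\<omega>. 0 \<partial>M)"
    by (intro nn_integral_cong_AE) (auto elim!: eventually_mono)
  then show ?thesis using \<open>a = 1\<close> by simp
qed

lemma prob_null_le:
  assumes i [measurable]: "i \<in> {1..m}" and t: "t \<in> {0..1}"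
  shows "prob {\<omega> \<in> space M. P i \<omega> \<le> t \<and> \<not> H i \<omega>} = (1 - a) * t"
proof -
  have "emeasure M {\<omega> \<in> space M. P i \<omega> \<le> t \<and> \<not> H i \<omega>}
      = (\<integral>\<^sup>+\<omega>. indicator {..t} (P i \<omega>) * indicator {\<omega> \<in> space M. \<not> H i \<omega>} \<omega> \<partial>M)"
  proof -
    have "emeasure M {\<omega> \<in> space M. P i \<omega> \<le> t \<and> \<not> H i \<omega>}
        = (\<integral>\<^sup>+\<omega>. indicator {\<omega> \<in> space M. P i \<omega> \<le> t \<and> \<not> H i \<omega>} \<omega> \<partial>M)"
      by (rule nn_integral_indicator[symmetric]) simp
    also have "\<dots> = (\<integral>\<^sup>+\<omega>. indicator {..t} (P i \<omega>) * indicator {\<omega> \<in> space M. \<not> H i \<omega>} \<omega> \<partial>M)"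
      by (intro nn_integral_cong) (auto split: split_indicator)
    finally show ?thesis .
  qed
  also have "\<dots> = ennreal (1 - a) * (\<integral>\<^sup>+x. indicator {..t} x * indicator {0<..<1} x \<partial>lborel)"
    by (rule nn_integral_null[OF i]) simp
  also have "(\<integral>\<^sup>+x. indicator {..t} x * indicator {0<..<1} x \<partial>lborel)
      = (\<integral>\<^sup>+x. indicator {0..t} x \<partial>lborel)"
    using AE_lborel_singleton[of 0] AE_lborel_singleton[of 1] t
    by (intro nn_integral_cong_AE) (auto elim!: eventually_elim2 split: split_indicator)
  also have "\<dots> = ennreal t" using t by simp
  also have "ennreal (1 - a) * ennreal t = ennreal ((1 - a) * t)"
    using t a_le_1 by (simp add: ennreal_mult)
  finally show ?thesis using t a_le_1 by (simp add: emeasure_eq_measure)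
qed

lemma prob_alternative_le:
  assumes i [measurable]: "i \<in> {1..m}"
  shows "prob {\<omega> \<in> space M. P i \<omega> \<le> t \<and> H i \<omega>} = a * F t"
proof (cases "0 < a")
  case True
  let ?A = "{\<omega> \<in> space M. H i \<omega>}"
  have "F t = measure (distr (uniform_measure M ?A) borel (P i)) {..t}"
    unfolding P_alternative[OF i True, symmetric] by (simp add: cdf_def)
  also have "\<dots> = measure (uniform_measure M ?A) {\<omega> \<in> space M. P i \<omega> \<le> t}"
    by (subst measure_distr) (auto intro!: arg_cong2[where f = measure])
  also have "\<dots> = prob (?A \<inter> {\<omega> \<in> space M. P i \<omega> \<le> t}) / prob ?A"
    using True prob_alternative[OF i] by (intro measure_uniform_measure) (auto simp: emeasure_eq_measure)
  also have "?A \<inter> {\<omega> \<in> space M. P i \<omega> \<le> t} = {\<omega> \<in> space M. P i \<omega> \<le> t \<and> H i \<omega>}" by auto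
  finally show ?thesis using True by (simp add: prob_alternative[OF i])
next
  case False
  then have "a = 0" using a_nonneg by simp
  have "prob {\<omega> \<in> space M. P i \<omega> \<le> t \<and> H i \<omega>} \<le> prob {\<omega> \<in> space M. H i \<omega>}"
    by (intro finite_measure_mono) auto
  then show ?thesis using prob_alternative[OF i] \<open>a = 0\<close> by (simp add: measure_le_0_iff)
qed

lemma prob_le:
  assumes i [measurable]: "i \<in> {1..m}" and t: "t \<in> {0..1}"
  shows "prob {\<omega> \<in> space M. P i \<omega> \<le> t} = G t"
proof -
  have "{\<omega> \<in> space M. P i \<omega> \<le> t} =
    {\<omega> \<in> space M. P i \<omega> \<le> t \<and> \<not> H i \<omega>} \<union> {\<omega> \<in> space M. P i \<omega> \<le> t \<and> H i \<omega>}" by auto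
  also have "prob \<dots> = prob {\<omega> \<in> space M. P i \<omega> \<le> t \<and> \<not> H i \<omega>} + prob {\<omega> \<in> space M. P i \<omega> \<le> t \<and> H i \<omega>}"
    by (intro finite_measure_Union) auto
  finally show ?thesis
    by (simp add: prob_null_le[OF i t] prob_alternative_le[OF i] mixture_cdf_def)
qed

text \<open>Both laws have distribution function \<open>G\<close> on \<open>[0,1]\<close>. The values \<open>G 0 = 0\<close> and \<open>G 1 = 1\<close> settle the
  arguments outside.\<close>

lemma distr_P:
  assumes concave: "concave_on {0..1} G" and i [measurable]: "i \<in> {1..m}"
  shows "distr M borel (P i) = density lborel (\<lambda>x. ennreal (indicator {0..1} x * g x))"
    (is "?D = ?N")
proof -
  have [measurable]: "(\<lambda>x. indicator {0..1} x * g x) \<in> borel_measurable borel"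
    using g_integrable by (simp add: set_integrable_def)
  have nonneg: "AE x in lborel. 0 \<le> indicator {0..1} x * g x"
    using g_nonneg[OF concave] AE_lborel_singleton[of 0] AE_lborel_singleton[of 1]
    by eventually_elim (auto split: split_indicator)
  have N: "emeasure ?N {..t} = ennreal (G t)" if "t \<in> {0..1}" for t
  proof -
    have "emeasure ?N {..t} = (\<integral>\<^sup>+x. ennreal (indicator {0..1} x * g x) * indicator {..t} x \<partial>lborel)"
      by (subst emeasure_density) auto
    also have "\<dots> = (\<integral>\<^sup>+x. ennreal (indicator {0..t} x *\<^sub>R g x) \<partial>lborel)"
      using that by (intro nn_integral_cong) (auto split: split_indicator)
    also have "\<dots> = ennreal (LINT x:{0..t}|lborel. g x)"
      unfolding set_lebesgue_integral_def
    proof (rule nn_integral_eq_integral)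
      show "integrable lborel (\<lambda>x. indicator {0..t} x *\<^sub>R g x)"
        using set_integrable_subset[OF g_integrable, of "{0..t}"] that by (auto simp: set_integrable_def)
      show "AE x in lborel. 0 \<le> indicator {0..t} x *\<^sub>R g x"
        by (rule AE_mp[OF nonneg], intro AE_I2)
           (use that in \<open>auto split: split_indicator split_indicator_asm\<close>)
    qed
    finally show ?thesis by (simp add: g_density[OF that])
  qed
  have D: "emeasure ?D {..t} = ennreal (G t)" if "t \<in> {0..1}" for t
    by (subst emeasure_distr)
       (auto simp: prob_le[OF i that, symmetric] emeasure_eq_measure intro!: arg_cong[where f = prob])
  have N_space: "emeasure ?N UNIV = 1"
  proof -
    have "emeasure ?N UNIV = emeasure ?N {..1}"
      by (auto simp: emeasure_density intro!: nn_integral_cong split: split_indicator)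
    then show ?thesis by (simp add: N mixture_cdf_1)
  qed
  interpret D: prob_space ?D by (intro prob_space_distr) simp
  interpret N: prob_space ?N by (rule prob_spaceI) (simp only: space_density space_lborel space_borel N_space)
  have "cdf ?D t = cdf ?N t" for t
  proof -
    consider "t < 0" | "t \<in> {0..1}" | "1 < t" by force
    then show ?thesis
    proof cases
      case 1
      have "measure ?D {..t} \<le> measure ?D {..0}" using 1 by (intro D.finite_measure_mono) auto
      moreover have "measure ?N {..t} \<le> measure ?N {..0}" using 1 by (intro N.finite_measure_mono) auto
      moreover have "measure ?D {..0} = 0" "measure ?N {..0} = 0"
        using N[of 0] D[of 0] by (simp_all add: measure_def mixture_cdf_0)
      ultimately show ?thesis by (simp add: cdf_def measure_le_0_iff)
    next
      case 2
      then show ?thesis using N D by (simp add: cdf_def measure_def)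
    next
      case 3
      have "measure ?D {..1} \<le> measure ?D {..t}" using 3 by (intro D.finite_measure_mono) auto
      moreover have "measure ?N {..1} \<le> measure ?N {..t}" using 3 by (intro N.finite_measure_mono) auto
      moreover have "measure ?D {..1} = 1" "measure ?N {..1} = 1"
        using N[of 1] D[of 1] by (simp_all add: measure_def mixture_cdf_1)
      ultimately show ?thesis using D.prob_le_1[of "{..t}"] N.prob_le_1[of "{..t}"] by (simp add: cdf_def)
    qed
  qed
  then show ?thesis
    by (intro cdf_unique ext) (unfold_locales, simp_all)
qed

text \<open>On \<open>(0, \<epsilon>]\<close> the joint law of a p-value and a null label has density \<open>1 - a \<le> c \<gamma> \<le> c g\<close>: the
  local false discovery rate is at most \<open>c\<close> there. The formulation without division also covers
  \<open>a = 1\<close>, where \<open>\<gamma>\<close> may vanish.\<close>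

lemma null_mass_le:
  assumes concave: "concave_on {0..1} G" and i [measurable]: "i \<in> {1..m}"
    and [measurable]: "\<psi> \<in> borel_measurable borel"
    and "\<epsilon> < 1" and \<psi>: "\<And>x. \<epsilon> < x \<Longrightarrow> \<psi> x = 0"
    and dens: "AE x in lborel. x \<in> {0<..\<epsilon>} \<longrightarrow> \<gamma> \<le> g x"
    and c: "0 \<le> c" "1 - a \<le> c * \<gamma>"
  shows "(\<integral>\<^sup>+\<omega>. \<psi> (P i \<omega>) * indicator {\<omega> \<in> space M. \<not> H i \<omega>} \<omega> \<partial>M)
    \<le> ennreal c * (\<integral>\<^sup>+\<omega>. \<psi> (P i \<omega>) \<partial>M)"
proof -
  have [measurable]: "(\<lambda>x. indicator {0..1} x * g x) \<in> borel_measurable borel"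
    using g_integrable by (simp add: set_integrable_def)
  have "(\<integral>\<^sup>+\<omega>. \<psi> (P i \<omega>) * indicator {\<omega> \<in> space M. \<not> H i \<omega>} \<omega> \<partial>M)
    = ennreal (1 - a) * (\<integral>\<^sup>+x. \<psi> x * indicator {0<..<1} x \<partial>lborel)"
    by (rule nn_integral_null[OF i]) simp
  also have "\<dots> = (\<integral>\<^sup>+x. ennreal (1 - a) * (\<psi> x * indicator {0<..<1} x) \<partial>lborel)"
    by (rule nn_integral_cmult[symmetric]) simp
  also have "\<dots> \<le> (\<integral>\<^sup>+x. ennreal c * (ennreal (indicator {0..1} x * g x) * \<psi> x) \<partial>lborel)"
  proof (rule nn_integral_mono_AE, use dens in eventually_elim)
    case (elim x)
    show ?case
    proof (cases "x \<in> {0<..\<epsilon>}")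
      case True
      have "1 - a \<le> c * g x" using elim True c by (meson mult_left_mono order_trans)
      then have "ennreal (1 - a) * \<psi> x \<le> ennreal (c * g x) * \<psi> x"
        by (intro mult_right_mono ennreal_leI) auto
      then show ?thesis using True \<open>\<epsilon> < 1\<close> c by (simp add: ennreal_mult' mult.assoc)
    next
      case False
      then show ?thesis using \<psi>[of x] by (auto split: split_indicator)
    qed
  qed
  also have "\<dots> = ennreal c * (\<integral>\<^sup>+x. ennreal (indicator {0..1} x * g x) * \<psi> x \<partial>lborel)"
    by (rule nn_integral_cmult) simp
  also have "(\<integral>\<^sup>+x. ennreal (indicator {0..1} x * g x) * \<psi> x \<partial>lborel) = (\<integral>\<^sup>+x. \<psi> x \<partial>distr M borel (P i))"
    unfolding distr_P[OF concave i] by (subst nn_integral_density) auto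
  also have "\<dots> = (\<integral>\<^sup>+\<omega>. \<psi> (P i \<omega>) \<partial>M)" by (subst nn_integral_distr) auto
  finally show ?thesis .
qed

end

section \<open>Conditioning on the p-values\<close>

text \<open>Without rejections the numerator vanishes, and \<open>0 / 0 = 0\<close> takes over the role of the second
  summand in the denominator.\<close>

lemma fdp_eq:
  "fdp m p h t = (\<Sum>i=1..m. of_bool (p i \<le> t \<and> \<not> h i)) / real (num_le m p t)"
proof (cases "\<exists>i\<in>{1..m}. p i \<le> t")
  case True
  then have "\<not> (\<forall>i\<in>{1..m}. t < p i)" by force
  then have "of_bool (\<forall>i\<in>{1..m}. t < p i) = (0::real)" by simp
  moreover have "(\<Sum>i=1..m. of_bool (p i \<le> t) * (1 - of_bool (h i)))
      = (\<Sum>i=1..m. of_bool (p i \<le> t \<and> \<not> h i) :: real)"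
    by (intro sum.cong) auto
  ultimately show ?thesis unfolding fdp_def num_le_sum by simp
next
  case False
  then have *: "of_bool (p i \<le> t) = (0::real)" "of_bool (p i \<le> t \<and> \<not> h i) = (0::real)" if "i \<in> {1..m}" for i
    using that by auto
  show ?thesis unfolding fdp_def by (simp add: *)
qed

lemma fdp_range: "0 \<le> fdp m p h t" "fdp m p h t \<le> 1"
proof -
  show "0 \<le> fdp m p h t" unfolding fdp_eq by (intro divide_nonneg_nonneg sum_nonneg) auto
  have "(\<Sum>i=1..m. of_bool (p i \<le> t \<and> \<not> h i)) \<le> real (num_le m p t)"
    unfolding num_le_sum by (intro sum_mono) auto
  then show "fdp m p h t \<le> 1"
    unfolding fdp_eq by (cases "num_le m p t = 0") (simp_all only: of_nat_0 div_by_0 zero_le_one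
      divide_le_eq_1 of_nat_0_less_iff neq0_conv, simp)
qed

lemma num_le_restrict: "num_le m (\<lambda>i\<in>{1..m}. p i) t = num_le m p t"
  unfolding num_le_def by (intro arg_cong[where f = card]) auto

lemma empirical_cdf_restrict: "empirical_cdf m (\<lambda>i\<in>{1..m}. p i) = empirical_cdf m p"
  by (intro ext) (simp only: empirical_cdf_num_le num_le_restrict)

context two_groups_sample
begin

definition pvals :: "'a \<Rightarrow> nat \<Rightarrow> real" where
  "pvals \<omega> = (\<lambda>i\<in>{1..m}. P i \<omega>)"

lemma pvals_apply [simp]: "i \<in> {1..m} \<Longrightarrow> pvals \<omega> i = P i \<omega>"
  by (simp add: pvals_def)

lemma num_le_pvals: "num_le m (pvals \<omega>) t = num_le m (\<lambda>i. P i \<omega>) t"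
  by (simp add: pvals_def num_le_restrict)

lemma pvals_measurable [measurable]: "pvals \<in> M \<rightarrow>\<^sub>M Pi\<^sub>M {1..m} (\<lambda>_. borel)"
  unfolding pvals_def by (intro measurable_restrict) simp

abbreviation others :: "nat \<Rightarrow> 'a \<Rightarrow> nat \<Rightarrow> real" where
  "others i \<omega> \<equiv> \<lambda>j\<in>{1..m} - {i}. P j \<omega>"

lemma others_measurable [measurable]: "others i \<in> M \<rightarrow>\<^sub>M Pi\<^sub>M ({1..m} - {i}) (\<lambda>_. borel)"
  by (intro measurable_restrict) simp

text \<open>Independence in the form of Fubini's theorem on the product of the sample space with itself:
  \<open>\<omega>\<close> carries the pair \<open>i\<close> and \<open>\<omega>'\<close> carries the remaining p-values.\<close>

lemma nn_integral_split_coordinate: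
  assumes i: "i \<in> {1..m}"
    and f [measurable]: "f \<in> borel_measurable
      ((borel \<Otimes>\<^sub>M count_space UNIV) \<Otimes>\<^sub>M Pi\<^sub>M ({1..m} - {i}) (\<lambda>_. borel))"
  shows "(\<integral>\<^sup>+\<omega>. f ((P i \<omega>, H i \<omega>), others i \<omega>) \<partial>M)
    = (\<integral>\<^sup>+\<omega>'. (\<integral>\<^sup>+\<omega>. f ((P i \<omega>, H i \<omega>), others i \<omega>') \<partial>M) \<partial>M)"
proof -
  let ?N = "borel \<Otimes>\<^sub>M count_space UNIV :: (real \<times> bool) measure"
  let ?J = "{1..m} - {i}"
  let ?K = "Pi\<^sub>M {i} (\<lambda>_. ?N)" and ?L = "Pi\<^sub>M ?J (\<lambda>_. ?N)"
  let ?X = "\<lambda>\<omega>. \<lambda>j\<in>{i}. (P j \<omega>, H j \<omega>)" and ?Y = "\<lambda>\<omega>. \<lambda>j\<in>?J. (P j \<omega>, H j \<omega>)"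
  define F where "F z = f (fst z i, \<lambda>j\<in>?J. fst (snd z j))"
    for z :: "(nat \<Rightarrow> real \<times> bool) \<times> (nat \<Rightarrow> real \<times> bool)"
  have rv [measurable]: "?X \<in> M \<rightarrow>\<^sub>M ?K" "?Y \<in> M \<rightarrow>\<^sub>M ?L"
    and joint: "distr M ?K ?X \<Otimes>\<^sub>M distr M ?L ?Y = distr M (?K \<Otimes>\<^sub>M ?L) (\<lambda>\<omega>. (?X \<omega>, ?Y \<omega>))"
    using indep_var_restrict[OF indep_pairs, of "{i}" ?J] i unfolding indep_var_distribution_eq by auto
  have [measurable]: "(\<lambda>y. \<lambda>j\<in>?J. fst (y j)) \<in> ?L \<rightarrow>\<^sub>M Pi\<^sub>M ?J (\<lambda>_. borel)"
    by (intro measurable_restrict measurable_compose[OF measurable_component_singleton]) auto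
  have [measurable]: "(\<lambda>x. x i) \<in> ?K \<rightarrow>\<^sub>M ?N" by (rule measurable_component_singleton) simp
  have F [measurable]: "F \<in> borel_measurable (?K \<Otimes>\<^sub>M ?L)" unfolding F_def by measurable
  interpret X: prob_space "distr M ?K ?X" by (rule prob_space_distr) fact
  interpret Y: prob_space "distr M ?L ?Y" by (rule prob_space_distr) fact
  interpret XY: pair_sigma_finite "distr M ?K ?X" "distr M ?L ?Y" ..
  have X: "?X \<omega> i = (P i \<omega>, H i \<omega>)" for \<omega> by simp
  have others: "(\<lambda>j\<in>?J. fst (?Y \<omega> j)) = others i \<omega>" for \<omega> by (auto simp: restrict_def)
  have "(\<integral>\<^sup>+\<omega>. f ((P i \<omega>, H i \<omega>), others i \<omega>) \<partial>M) = (\<integral>\<^sup>+\<omega>. F (?X \<omega>, ?Y \<omega>) \<partial>M)"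
    by (simp only: F_def fst_conv snd_conv X others)
  also have "\<dots> = (\<integral>\<^sup>+z. F z \<partial>distr M (?K \<Otimes>\<^sub>M ?L) (\<lambda>\<omega>. (?X \<omega>, ?Y \<omega>)))"
    by (rule nn_integral_distr[symmetric]) measurable
  also have "\<dots> = (\<integral>\<^sup>+z. F z \<partial>(distr M ?K ?X \<Otimes>\<^sub>M distr M ?L ?Y))" by (simp add: joint)
  also have "\<dots> = (\<integral>\<^sup>+y. (\<integral>\<^sup>+x. F (x, y) \<partial>distr M ?K ?X) \<partial>distr M ?L ?Y)"
    by (rule XY.nn_integral_snd[symmetric]) (use F in \<open>simp cong: measurable_cong_sets\<close>)
  also have "\<dots> = (\<integral>\<^sup>+\<omega>'. (\<integral>\<^sup>+x. F (x, ?Y \<omega>') \<partial>distr M ?K ?X) \<partial>M)"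
    by (rule nn_integral_distr) measurable
  also have "\<dots> = (\<integral>\<^sup>+\<omega>'. (\<integral>\<^sup>+\<omega>. F (?X \<omega>, ?Y \<omega>') \<partial>M) \<partial>M)"
  proof (rule nn_integral_cong)
    fix \<omega>' assume "\<omega>' \<in> space M"
    then have "?Y \<omega>' \<in> space ?L" by (rule measurable_space[OF rv(2)])
    then have meas: "(\<lambda>x. F (x, ?Y \<omega>')) \<in> borel_measurable ?K"
      by (rule measurable_compose[OF measurable_Pair2' F])
    show "(\<integral>\<^sup>+x. F (x, ?Y \<omega>') \<partial>distr M ?K ?X) = (\<integral>\<^sup>+\<omega>. F (?X \<omega>, ?Y \<omega>') \<partial>M)"
      by (intro nn_integral_distr rv) (use meas in simp)
  qed
  finally show ?thesis
    by (simp only: F_def fst_conv snd_conv X others)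
qed

text \<open>The other p-values do not influence the pair \<open>i\<close>, so they may be frozen and the bound for
  functions of a single p-value applies.\<close>

lemma null_mass_le_pvals:
  assumes concave: "concave_on {0..1} G" and i: "i \<in> {1..m}"
    and \<phi> [measurable]: "\<phi> \<in> borel_measurable (Pi\<^sub>M {1..m} (\<lambda>_. borel))"
    and "\<epsilon> < 1" and \<phi>0: "\<And>p. \<epsilon> < p i \<Longrightarrow> \<phi> p = 0"
    and dens: "AE x in lborel. x \<in> {0<..\<epsilon>} \<longrightarrow> \<gamma> \<le> g x"
    and c: "0 \<le> c" "1 - a \<le> c * \<gamma>"
  shows "(\<integral>\<^sup>+\<omega>. \<phi> (pvals \<omega>) * indicator {\<omega> \<in> space M. \<not> H i \<omega>} \<omega> \<partial>M)
    \<le> ennreal c * (\<integral>\<^sup>+\<omega>. \<phi> (pvals \<omega>) \<partial>M)"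
proof -
  let ?R = "Pi\<^sub>M ({1..m} - {i}) (\<lambda>_. borel) :: (nat \<Rightarrow> real) measure"
  let ?N = "borel \<Otimes>\<^sub>M count_space UNIV :: (real \<times> bool) measure"
  have pvals: "pvals \<omega> = (others i \<omega>)(i := P i \<omega>)" for \<omega>
    using i by (auto simp: fun_eq_iff restrict_def pvals_def)
  have update [measurable]: "(\<lambda>z. (snd z)(i := fst (fst z))) \<in> ?N \<Otimes>\<^sub>M ?R \<rightarrow>\<^sub>M Pi\<^sub>M {1..m} (\<lambda>_. borel)"
    by (rule measurable_fun_upd[where J = "{1..m} - {i}"]) (use i in auto)
  have upd [measurable]: "(\<lambda>x. y(i := x)) \<in> borel \<rightarrow>\<^sub>M Pi\<^sub>M {1..m} (\<lambda>_. borel)" if "y \<in> space ?R" for y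
    by (rule measurable_fun_upd[where J = "{1..m} - {i}"]) (use i that in auto)
  have "(\<integral>\<^sup>+\<omega>. \<phi> (pvals \<omega>) * indicator {\<omega> \<in> space M. \<not> H i \<omega>} \<omega> \<partial>M)
    = (\<integral>\<^sup>+\<omega>. (\<lambda>z. \<phi> ((snd z)(i := fst (fst z))) * indicator {z. \<not> snd (fst z)} z) ((P i \<omega>, H i \<omega>), others i \<omega>) \<partial>M)"
    unfolding pvals by (intro nn_integral_cong) (auto split: split_indicator)
  also have "\<dots> = (\<integral>\<^sup>+\<omega>'. (\<integral>\<^sup>+\<omega>. \<phi> ((others i \<omega>')(i := P i \<omega>)) * indicator {\<omega> \<in> space M. \<not> H i \<omega>} \<omega> \<partial>M) \<partial>M)"
  proof (subst nn_integral_split_coordinate[OF i])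
    have [measurable]: "Measurable.pred (?N \<Otimes>\<^sub>M ?R) (\<lambda>z. \<not> snd (fst z))" by measurable
    show "(\<lambda>z. \<phi> ((snd z)(i := fst (fst z))) * indicator {z. \<not> snd (fst z)} z)
      \<in> borel_measurable (?N \<Otimes>\<^sub>M ?R)" by measurable
  qed (auto intro!: nn_integral_cong split: split_indicator)
  also have "\<dots> \<le> (\<integral>\<^sup>+\<omega>'. ennreal c * (\<integral>\<^sup>+\<omega>. \<phi> ((others i \<omega>')(i := P i \<omega>)) \<partial>M) \<partial>M)"
  proof (rule nn_integral_mono)
    fix \<omega>' assume "\<omega>' \<in> space M"
    then have "others i \<omega>' \<in> space ?R" by (rule measurable_space[OF others_measurable])
    note this = measurable_compose[OF upd[OF this] \<phi>]
    from null_mass_le[OF concave i this \<open>\<epsilon> < 1\<close> _ dens c]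
    show "(\<integral>\<^sup>+\<omega>. \<phi> ((others i \<omega>')(i := P i \<omega>)) * indicator {\<omega> \<in> space M. \<not> H i \<omega>} \<omega> \<partial>M)
      \<le> ennreal c * (\<integral>\<^sup>+\<omega>. \<phi> ((others i \<omega>')(i := P i \<omega>)) \<partial>M)" by (simp add: \<phi>0)
  qed
  also have "\<dots> = (\<integral>\<^sup>+\<omega>'. (\<integral>\<^sup>+\<omega>. ennreal c * \<phi> ((others i \<omega>')(i := P i \<omega>)) \<partial>M) \<partial>M)"
  proof (rule nn_integral_cong)
    fix \<omega>' assume "\<omega>' \<in> space M"
    then have "others i \<omega>' \<in> space ?R" by (rule measurable_space[OF others_measurable])
    from measurable_compose[OF upd[OF this] \<phi>] have [measurable]: "(\<lambda>x. \<phi> ((others i \<omega>')(i := x))) \<in> borel_measurable borel" .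
    have "(\<lambda>\<omega>. \<phi> ((others i \<omega>')(i := P i \<omega>))) \<in> borel_measurable M" using i by measurable
    then show "ennreal c * (\<integral>\<^sup>+\<omega>. \<phi> ((others i \<omega>')(i := P i \<omega>)) \<partial>M) = (\<integral>\<^sup>+\<omega>. ennreal c * \<phi> ((others i \<omega>')(i := P i \<omega>)) \<partial>M)"
      by (rule nn_integral_cmult[symmetric])
  qed
  also have "\<dots> = (\<integral>\<^sup>+\<omega>. (\<lambda>z. ennreal c * \<phi> ((snd z)(i := fst (fst z)))) ((P i \<omega>, H i \<omega>), others i \<omega>) \<partial>M)"
  proof (subst nn_integral_split_coordinate[OF i])
    show "(\<lambda>z. ennreal c * \<phi> ((snd z)(i := fst (fst z)))) \<in> borel_measurable (?N \<Otimes>\<^sub>M ?R)"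
      by (intro borel_measurable_times_ennreal borel_measurable_const measurable_compose[OF update \<phi>])
  qed (simp only: fst_conv snd_conv)
  also have "\<dots> = (\<integral>\<^sup>+\<omega>. ennreal c * \<phi> (pvals \<omega>) \<partial>M)" unfolding pvals by simp
  also have "\<dots> = ennreal c * (\<integral>\<^sup>+\<omega>. \<phi> (pvals \<omega>) \<partial>M)" by (rule nn_integral_cmult) measurable
  finally show ?thesis .
qed

lemma fdp_measurable:
  assumes [measurable]: "\<tau> \<in> borel_measurable (Pi\<^sub>M {1..m} (\<lambda>_. borel))"
  shows "(\<lambda>\<omega>. fdp m (\<lambda>i. P i \<omega>) (\<lambda>i. H i \<omega>) (\<tau> (pvals \<omega>))) \<in> borel_measurable M"
proof -
  have "fdp m (\<lambda>i. P i \<omega>) (\<lambda>i. H i \<omega>) (\<tau> (pvals \<omega>)) =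
    (\<Sum>i=1..m. if P i \<omega> \<le> \<tau> (pvals \<omega>) \<and> \<not> H i \<omega> then 1 else 0) /
    real (num_le m (pvals \<omega>) (\<tau> (pvals \<omega>)))" for \<omega>
    unfolding fdp_eq num_le_pvals of_bool_def ..
  moreover have "(\<lambda>\<omega>. real (num_le m (pvals \<omega>) (\<tau> (pvals \<omega>)))) \<in> borel_measurable M"
    using measurable_compose[OF pvals_measurable num_le_measurable[OF assms]] .
  ultimately show ?thesis by simp measurable
qed

text \<open>With \<open>\<phi> i\<close> the indicator of rejecting \<open>i\<close> divided by the number of rejections, the false
  discovery proportion is the sum of \<open>\<phi> i\<close> over the nulls. Each label costs a factor \<open>c\<close>, and
  without labels the \<open>\<phi> i\<close> add up to the indicator of at least one rejection. The threshold may
  depend on the p-values in any measurable way.\<close>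

lemma expectation_fdp_le_rejection_prob:
  assumes concave: "concave_on {0..1} G"
    and \<tau> [measurable]: "\<tau> \<in> borel_measurable (Pi\<^sub>M {1..m} (\<lambda>_. borel))"
    and A [measurable]: "A \<in> sets (Pi\<^sub>M {1..m} (\<lambda>_. borel))"
    and small: "\<And>p. p \<in> A \<Longrightarrow> \<tau> p \<le> \<epsilon>" and "\<epsilon> < 1"
    and dens: "AE x in lborel. x \<in> {0<..\<epsilon>} \<longrightarrow> \<gamma> \<le> g x"
    and c: "0 \<le> c" "1 - a \<le> c * \<gamma>"
  shows "expectation (\<lambda>\<omega>. fdp m (\<lambda>i. P i \<omega>) (\<lambda>i. H i \<omega>) (\<tau> (pvals \<omega>)) * indicator A (pvals \<omega>))
    \<le> c * prob {\<omega> \<in> space M. pvals \<omega> \<in> A \<and> 0 < num_le m (pvals \<omega>) (\<tau> (pvals \<omega>))}"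
proof -
  define \<phi> where "\<phi> i p = ennreal (of_bool (p \<in> A \<and> p i \<le> \<tau> p) / real (num_le m p (\<tau> p)))"
    for i and p :: "nat \<Rightarrow> real"
  let ?X = "\<lambda>\<omega>. fdp m (\<lambda>i. P i \<omega>) (\<lambda>i. H i \<omega>) (\<tau> (pvals \<omega>)) * indicator A (pvals \<omega>)"
  let ?E = "{\<omega> \<in> space M. pvals \<omega> \<in> A \<and> 0 < num_le m (pvals \<omega>) (\<tau> (pvals \<omega>))}"
  have \<phi> [measurable]: "\<phi> i \<in> borel_measurable (Pi\<^sub>M {1..m} (\<lambda>_. borel))" if [simp]: "i \<in> {1..m}" for i
  proof -
    have "(\<lambda>p. p i) \<in> borel_measurable (Pi\<^sub>M {1..m} (\<lambda>_. borel))"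
      by (rule measurable_component_singleton) (use that in blast)
    have "{p \<in> space (Pi\<^sub>M {1..m} (\<lambda>_. borel)). p i \<le> \<tau> p} \<in> sets (Pi\<^sub>M {1..m} (\<lambda>_. borel))"
      by (intro borel_measurable_le \<tau>) fact
    then have "{p \<in> space (Pi\<^sub>M {1..m} (\<lambda>_. borel)). p \<in> A \<and> p i \<le> \<tau> p} \<in> sets (Pi\<^sub>M {1..m} (\<lambda>_. borel))"
      using A by measurable
    then have "(\<lambda>p. if p \<in> A \<and> p i \<le> \<tau> p then 1 else 0 :: real) \<in> borel_measurable (Pi\<^sub>M {1..m} (\<lambda>_. borel))"
      by (intro measurable_If) auto
    then show ?thesis
      unfolding \<phi>_def of_bool_def
      by (intro measurable_compose[OF _ measurable_ennreal] borel_measurable_divide num_le_measurable \<tau>)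
  qed
  have X [measurable]: "?X \<in> borel_measurable M"
    using fdp_measurable[OF \<tau>] by measurable
  have E [measurable]: "?E \<in> events"
  proof -
    have "(\<lambda>\<omega>. real (num_le m (pvals \<omega>) (\<tau> (pvals \<omega>)))) \<in> borel_measurable M"
      using measurable_compose[OF pvals_measurable num_le_measurable[OF \<tau>]] .
    then have "{\<omega> \<in> space M. pvals \<omega> \<in> A \<and> 0 < real (num_le m (pvals \<omega>) (\<tau> (pvals \<omega>)))} \<in> events"
      by measurable
    then show ?thesis by simp
  qed
  have "ennreal (expectation ?X) = (\<integral>\<^sup>+\<omega>. ennreal (?X \<omega>) \<partial>M)"
  proof (rule nn_integral_eq_integral[symmetric])
    show "integrable M ?X"
      by (intro integrable_const_bound[of _ 1] AE_I2 X) (use fdp_range in \<open>auto simp: indicator_def\<close>)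
  qed (auto simp: fdp_range)
  also have "\<dots> = (\<integral>\<^sup>+\<omega>. (\<Sum>i=1..m. \<phi> i (pvals \<omega>) * indicator {\<omega> \<in> space M. \<not> H i \<omega>} \<omega>) \<partial>M)"
  proof (rule nn_integral_cong)
    fix \<omega> assume \<omega>: "\<omega> \<in> space M"
    let ?p = "pvals \<omega>" let ?n = "real (num_le m ?p (\<tau> ?p))"
    have "?X \<omega> = (\<Sum>i=1..m. of_bool (?p \<in> A \<and> ?p i \<le> \<tau> ?p) / ?n * indicator {\<omega> \<in> space M. \<not> H i \<omega>} \<omega>)"
      unfolding fdp_eq num_le_pvals sum_divide_distrib sum_distrib_right
    proof (intro sum.cong refl)
      fix i assume "i \<in> {1..m}"
      then have "?p i = P i \<omega>" by simp
      then show "of_bool (P i \<omega> \<le> \<tau> ?p \<and> \<not> H i \<omega>) / real (num_le m (\<lambda>i. P i \<omega>) (\<tau> ?p)) * indicator A ?p =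
        of_bool (?p \<in> A \<and> ?p i \<le> \<tau> ?p) / real (num_le m (\<lambda>i. P i \<omega>) (\<tau> ?p)) *
        indicator {\<omega> \<in> space M. \<not> H i \<omega>} \<omega>"
        using \<omega> by (cases "?p \<in> A"; cases "H i \<omega>") simp_all
    qed
    then have "ennreal (?X \<omega>) = ennreal (\<Sum>i=1..m. of_bool (?p \<in> A \<and> ?p i \<le> \<tau> ?p) / ?n *
        indicator {\<omega> \<in> space M. \<not> H i \<omega>} \<omega>)" by (rule arg_cong)
    also have "\<dots> = (\<Sum>i=1..m. ennreal (of_bool (?p \<in> A \<and> ?p i \<le> \<tau> ?p) / ?n *
        indicator {\<omega> \<in> space M. \<not> H i \<omega>} \<omega>))"
      by (rule sum_ennreal[symmetric]) simp
    also have "\<dots> = (\<Sum>i=1..m. \<phi> i ?p * indicator {\<omega> \<in> space M. \<not> H i \<omega>} \<omega>)"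
      unfolding \<phi>_def by (intro sum.cong refl) (simp only: ennreal_mult'' ennreal_indicator indicator_pos_le)
    finally show "ennreal (?X \<omega>) = (\<Sum>i=1..m. \<phi> i (pvals \<omega>) * indicator {\<omega> \<in> space M. \<not> H i \<omega>} \<omega>)" .
  qed
  also have "\<dots> = (\<Sum>i=1..m. \<integral>\<^sup>+\<omega>. \<phi> i (pvals \<omega>) * indicator {\<omega> \<in> space M. \<not> H i \<omega>} \<omega> \<partial>M)"
    by (intro nn_integral_sum) measurable
  also have "\<dots> \<le> (\<Sum>i=1..m. ennreal c * (\<integral>\<^sup>+\<omega>. \<phi> i (pvals \<omega>) \<partial>M))"
  proof (intro sum_mono null_mass_le_pvals[OF concave _ _ \<open>\<epsilon> < 1\<close> _ dens c] \<phi>)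
    fix i and p :: "nat \<Rightarrow> real" assume "\<epsilon> < p i"
    then have "\<not> (p \<in> A \<and> p i \<le> \<tau> p)" using small[of p] by auto
    then show "\<phi> i p = 0" by (simp add: \<phi>_def)
  qed
  also have "\<dots> = ennreal c * (\<integral>\<^sup>+\<omega>. (\<Sum>i=1..m. \<phi> i (pvals \<omega>)) \<partial>M)"
    by (subst nn_integral_sum) (auto simp: sum_distrib_left)
  also have "(\<integral>\<^sup>+\<omega>. (\<Sum>i=1..m. \<phi> i (pvals \<omega>)) \<partial>M) = (\<integral>\<^sup>+\<omega>. indicator ?E \<omega> \<partial>M)"
  proof (rule nn_integral_cong)
    fix \<omega> assume \<omega>: "\<omega> \<in> space M"
    let ?p = "pvals \<omega>" let ?n = "real (num_le m ?p (\<tau> ?p))"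
    have "(\<Sum>i=1..m. \<phi> i ?p) = ennreal (\<Sum>i=1..m. of_bool (?p \<in> A \<and> ?p i \<le> \<tau> ?p) / ?n)"
      unfolding \<phi>_def by (intro sum_ennreal) auto
    also have "(\<Sum>i=1..m. of_bool (?p \<in> A \<and> ?p i \<le> \<tau> ?p) / ?n) = of_bool (?p \<in> A) * (?n / ?n)"
      unfolding num_le_sum[of m ?p] sum_divide_distrib[symmetric] by (cases "?p \<in> A") simp_all
    also have "\<dots> = indicator ?E \<omega>" using \<omega> by (auto simp: indicator_def)
    finally show "(\<Sum>i=1..m. \<phi> i ?p) = indicator ?E \<omega>" by (simp add: ennreal_indicator)
  qed
  also have "\<dots> = ennreal (prob ?E)" by (simp add: emeasure_eq_measure)
  also have "ennreal c * \<dots> = ennreal (c * prob ?E)" using c by (simp add: ennreal_mult)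
  finally show ?thesis using c by simp
qed

end

section \<open>Uniform laws of large numbers\<close>

lemma grid_of_small_oscillation:
  fixes L :: "real \<Rightarrow> real"
  assumes "continuous_on {0..1} L" "\<eta> > 0"
  obtains D where "finite D" "D \<subseteq> {0..1}"
    "\<And>t::real. t \<in> {0..1} \<Longrightarrow> \<exists>s\<in>D. \<exists>u\<in>D. s \<le> t \<and> t \<le> u \<and> L u - L s \<le> \<eta>"
proof -
  have "uniformly_continuous_on {0..1} L"
    using assms by (intro compact_uniformly_continuous) auto
  then obtain d where d: "d > 0"
    "\<And>x y. x \<in> {0..1} \<Longrightarrow> y \<in> {0..1} \<Longrightarrow> dist y x < d \<Longrightarrow> dist (L y) (L x) < \<eta>"
    unfolding uniformly_continuous_on_def using \<open>\<eta> > 0\<close> by blast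
  obtain n where n: "inverse (real (Suc n)) < d" using reals_Archimedean[OF d(1)] by blast
  define N where "N = Suc n"
  have N: "0 < real N" "1 / real N < d" using n by (auto simp: N_def inverse_eq_divide)
  let ?D = "(\<lambda>j. real j / N) ` {0..N}"
  show thesis
  proof (rule that[of ?D])
    show "?D \<subseteq> {0..1}" using N by (auto simp: divide_le_eq_1)
    fix t :: real assume t: "t \<in> {0..1}"
    show "\<exists>s\<in>?D. \<exists>u\<in>?D. s \<le> t \<and> t \<le> u \<and> L u - L s \<le> \<eta>"
    proof (cases "t = 1")
      case True
      then show ?thesis using N \<open>\<eta> > 0\<close> by (intro bexI[of _ 1] image_eqI[of 1 _ N]) auto
    next
      case False
      define j where "j = nat \<lfloor>t * N\<rfloor>"
      have j: "real j \<le> t * N" "t * N < real j + 1" using t N by (auto simp: j_def)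
      have "t * real N < 1 * real N" using t False N by (intro mult_strict_right_mono) auto
      with j have "j < N" by linarith
      let ?s = "real j / N" and ?u = "real (Suc j) / N"
      have "?s \<in> ?D" "?u \<in> ?D"
        using \<open>j < N\<close> by (auto intro!: imageI simp del: of_nat_Suc)
      moreover have "?s \<le> t" "t \<le> ?u" using j N by (auto simp: field_simps)
      moreover have "dist (L ?u) (L ?s) < \<eta>"
        using \<open>j < N\<close> N by (intro d(2)) (auto simp: divide_le_eq_1 dist_real_def diff_divide_distrib[symmetric])
      ultimately show ?thesis by (intro bexI[of _ ?s] bexI[of _ ?u]) (auto simp: dist_real_def)
    qed
  qed simp
qed

context two_groups_sample
begin

text \<open>Hoeffding's inequality controls the deviation on a finite grid. Between grid points both the
  count and its mean are monotone and the mean varies by at most \<open>\<eta>\<close>.\<close>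

lemma uniform_deviation:
  fixes L :: "real \<Rightarrow> real" and S :: "bool set"
  defines "c \<equiv> \<lambda>\<omega> t. (\<Sum>i=1..m. of_bool (P i \<omega> \<le> t \<and> H i \<omega> \<in> S) :: real)"
  assumes "1 \<le> m" and L: "\<And>i (t::real). i \<in> {1..m} \<Longrightarrow> t \<in> {0..1} \<Longrightarrow>
      prob {\<omega> \<in> space M. P i \<omega> \<le> t \<and> H i \<omega> \<in> S} = L t"
    and L_mono: "\<And>s (t::real). s \<in> {0..1} \<Longrightarrow> t \<in> {0..1} \<Longrightarrow> s \<le> t \<Longrightarrow> L s \<le> L t"
    and "\<eta> > 0" and D: "finite D" "D \<subseteq> {0..1}"
    "\<And>t::real. t \<in> {0..1} \<Longrightarrow> \<exists>s\<in>D. \<exists>u\<in>D. s \<le> t \<and> t \<le> u \<and> L u - L s \<le> \<eta>"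
  obtains B where "B \<in> events" "prob B \<le> real (card D) * (2 * exp (- 2 * \<eta>\<^sup>2 * m))"
    "\<And>\<omega> t. \<omega> \<in> space M - B \<Longrightarrow> t \<in> {0..1} \<Longrightarrow> \<bar>c \<omega> t / m - L t\<bar> \<le> 2 * \<eta>"
proof -
  define Bad where "Bad t = {\<omega> \<in> space M. \<bar>c \<omega> t - m * L t\<bar> \<ge> m * \<eta>}" for t
  have c_measurable [measurable]: "(\<lambda>\<omega>. c \<omega> t) \<in> borel_measurable M" for t
    unfolding c_def of_bool_def by measurable
  have Bad_events [measurable]: "Bad t \<in> events" for t unfolding Bad_def by measurable
  have Bad_prob: "prob (Bad t) \<le> 2 * exp (- 2 * \<eta>\<^sup>2 * m)" if t: "t \<in> {0..1}" for t
  proof -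
    let ?X = "\<lambda>i \<omega>. indicator {z. fst z \<le> t \<and> snd z \<in> S} (P i \<omega>, H i \<omega>) :: real"
    have S: "{z :: real \<times> bool. fst z \<le> t \<and> snd z \<in> S} \<in> sets (borel \<Otimes>\<^sub>M count_space UNIV)"
    proof -
      have "{..t} \<times> S \<in> sets (borel \<Otimes>\<^sub>M count_space UNIV)" by (intro pair_measureI) auto
      also have "{..t} \<times> S = {z. fst z \<le> t \<and> snd z \<in> S}" by auto
      finally show ?thesis .
    qed
    have "indep_vars (\<lambda>_. borel) ?X {1..m}"
      by (rule indep_vars_compose2[OF indep_pairs]) (use S in measurable)
    then interpret X: indep_interval_bounded_random_variables M "{1..m}" ?X "\<lambda>_. 0" "\<lambda>_. 1"
      by unfold_locales (auto simp: indicator_def)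
    interpret X: Hoeffding_ineq M "{1..m}" ?X "\<lambda>_. 0" "\<lambda>_. 1" "\<Sum>i\<in>{1..m}. expectation (?X i)"
      by unfold_locales simp
    have "expectation (?X i) = L t" if i: "i \<in> {1..m}" for i
    proof -
      have "expectation (?X i) = expectation (indicator {\<omega> \<in> space M. P i \<omega> \<le> t \<and> H i \<omega> \<in> S})"
        by (intro Bochner_Integration.integral_cong) (auto simp: indicator_def)
      also have "\<dots> = prob {\<omega> \<in> space M. P i \<omega> \<le> t \<and> H i \<omega> \<in> S}"
        using i by (subst Bochner_Integration.integral_indicator) (auto intro!: arg_cong[where f = prob])
      finally show ?thesis by (simp add: L[OF i t])
    qed
    then have mean: "(\<Sum>i=1..m. expectation (?X i)) = m * L t" by simp
    have sum: "(\<Sum>i=1..m. ?X i \<omega>) = c \<omega> t" for \<omega>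
      unfolding c_def by (intro sum.cong) (auto simp: indicator_def)
    have "prob {\<omega> \<in> space M. \<bar>(\<Sum>i=1..m. ?X i \<omega>) - (\<Sum>i=1..m. expectation (?X i))\<bar> \<ge> m * \<eta>}
      \<le> 2 * exp (- 2 * (m * \<eta>)\<^sup>2 / (\<Sum>i=1..m. (1 - 0)\<^sup>2))"
      using \<open>1 \<le> m\<close> \<open>\<eta> > 0\<close> by (intro X.Hoeffding_ineq_abs_ge) auto
    also have "- 2 * (m * \<eta>)\<^sup>2 / (\<Sum>i=1..m. (1 - 0)\<^sup>2) = - 2 * \<eta>\<^sup>2 * m"
      using \<open>1 \<le> m\<close> by (simp add: power2_eq_square field_simps)
    finally show ?thesis unfolding Bad_def mean sum .
  qed
  show thesis
  proof (rule that[of "\<Union>t\<in>D. Bad t"])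
    show "(\<Union>t\<in>D. Bad t) \<in> events" using D(1) by auto
    have "prob (\<Union>t\<in>D. Bad t) \<le> (\<Sum>t\<in>D. prob (Bad t))"
      using D(1) by (intro finite_measure_subadditive_finite) auto
    also have "\<dots> \<le> real (card D) * (2 * exp (- 2 * \<eta>\<^sup>2 * m))"
      using Bad_prob D(2) by (intro sum_bounded_above) auto
    finally show "prob (\<Union>t\<in>D. Bad t) \<le> real (card D) * (2 * exp (- 2 * \<eta>\<^sup>2 * m))" .
    fix \<omega> and t :: real assume \<omega>: "\<omega> \<in> space M - (\<Union>t\<in>D. Bad t)" and t: "t \<in> {0..1}"
    have "\<bar>c \<omega> s - m * L s\<bar> \<le> m * \<eta>" if "s \<in> D" for s
      using \<omega> that by (force simp: Bad_def)
    then have at_grid: "\<bar>c \<omega> s / m - L s\<bar> \<le> \<eta>" if "s \<in> D" for s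
      using \<open>1 \<le> m\<close> that by (fastforce simp: abs_le_iff field_simps)
    have c_mono: "c \<omega> s / m \<le> c \<omega> u / m" if "s \<le> u" for s u
      unfolding c_def using that by (intro divide_right_mono sum_mono) auto
    obtain s u where su: "s \<in> D" "u \<in> D" "s \<le> t" "t \<le> u" "L u - L s \<le> \<eta>" using D(3)[OF t] by auto
    then have "L s \<le> L t" "L t \<le> L u" using D(2) t by (auto intro!: L_mono)
    with su at_grid[OF su(1)] at_grid[OF su(2)] c_mono[OF su(3)] c_mono[OF su(4)]
    show "\<bar>c \<omega> t / m - L t\<bar> \<le> 2 * \<eta>" by (simp add: abs_le_iff)
  qed
qed

end

section \<open>The probability of crossing a line\<close>

text \<open>\<open>last_hit m i \<delta> p k\<close> says that \<open>k\<close> is the number of rejections of the step-up procedure with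
  critical values \<open>k \<delta>\<close> once \<open>p i\<close> has been replaced by \<open>0\<close>; this replacement is where the
  successor comes from. It depends on the other p-values only.\<close>

definition last_hit :: "nat \<Rightarrow> nat \<Rightarrow> real \<Rightarrow> (nat \<Rightarrow> real) \<Rightarrow> nat \<Rightarrow> bool" where
  "last_hit m i \<delta> p k \<longleftrightarrow> k \<le> Suc (card {j \<in> {1..m} - {i}. p j \<le> real k * \<delta>}) \<and>
     (\<forall>l\<in>{k<..m}. Suc (card {j \<in> {1..m} - {i}. p j \<le> real l * \<delta>}) < l)"

lemma last_hit_unique: "last_hit m i \<delta> p k \<Longrightarrow> last_hit m i \<delta> p l \<Longrightarrow> k \<le> m \<Longrightarrow> l \<le> m \<Longrightarrow> k = l"
  unfolding last_hit_def by (metis greaterThanAtMost_iff linorder_neqE_nat not_le)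

text \<open>Let \<open>K\<close> be the last \<open>k\<close> with at least \<open>k\<close> p-values not exceeding \<open>k \<delta>\<close>. Setting to \<open>0\<close> a p-value that is
  at most \<open>K \<delta>\<close> changes no count from \<open>K\<close> on, so \<open>K\<close> is also the last hit for each of the at least
  \<open>K\<close> such indices, and these contribute \<open>1 / K\<close> each.\<close>

lemma crossing_le_sum_last_hit:
  assumes "0 \<le> \<delta>" and crossing: "\<exists>k\<in>{1..m}. k \<le> num_le m p (real k * \<delta>)"
  shows "1 \<le> (\<Sum>i=1..m. \<Sum>k=1..m. of_bool (p i \<le> real k * \<delta> \<and> last_hit m i \<delta> p k) / real k)"
proof -
  define K where "K = Max {k \<in> {1..m}. k \<le> num_le m p (real k * \<delta>)}"
  have "K \<in> {k \<in> {1..m}. k \<le> num_le m p (real k * \<delta>)}"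
    unfolding K_def using crossing by (intro Max_in) auto
  then have K: "K \<in> {1..m}" "K \<le> num_le m p (real K * \<delta>)" by auto
  have K_max: "num_le m p (real l * \<delta>) < l" if "l \<in> {K<..m}" for l
  proof (rule ccontr)
    assume "\<not> num_le m p (real l * \<delta>) < l"
    then have "l \<le> K" unfolding K_def using that by (intro Max_ge) auto
    with that show False by simp
  qed
  have last: "last_hit m i \<delta> p K" if i: "i \<in> {1..m}" "p i \<le> real K * \<delta>" for i
  proof -
    have "Suc (card {j \<in> {1..m} - {i}. p j \<le> real l * \<delta>}) = num_le m p (real l * \<delta>)" if "K \<le> l" for l
    proof -
      have "real K * \<delta> \<le> real l * \<delta>" using that \<open>0 \<le> \<delta>\<close> by (intro mult_right_mono) auto
      then have "{j \<in> {1..m}. p j \<le> real l * \<delta>} = insert i {j \<in> {1..m} - {i}. p j \<le> real l * \<delta>}"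
        using i by auto
      then show ?thesis unfolding num_le_def by simp
    qed
    then show ?thesis using K K_max unfolding last_hit_def by auto
  qed
  have "1 \<le> real (num_le m p (real K * \<delta>)) / real K" using K by simp
  also have "\<dots> = (\<Sum>i=1..m. of_bool (p i \<le> real K * \<delta>) / real K)"
    unfolding num_le_sum sum_divide_distrib ..
  also have "\<dots> = (\<Sum>i=1..m. of_bool (p i \<le> real K * \<delta> \<and> last_hit m i \<delta> p K) / real K)"
    using last by (intro sum.cong) auto
  also have "\<dots> \<le> (\<Sum>i=1..m. \<Sum>k=1..m. of_bool (p i \<le> real k * \<delta> \<and> last_hit m i \<delta> p k) / real k)"
    using K by (intro sum_mono member_le_sum) auto
  finally show ?thesis .
qed

context two_groups_sample
begin

lemma last_hit_measurable [measurable]: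
  "Measurable.pred (Pi\<^sub>M ({1..m} - {i}) (\<lambda>_. borel)) (\<lambda>p. last_hit m i \<delta> p k)"
proof -
  have *: "real (card {j \<in> {1..m} - {i}. p j \<le> s}) = (\<Sum>j\<in>{1..m} - {i}. if p j \<le> s then 1 else 0)"
    for p :: "nat \<Rightarrow> real" and s
    by (subst sum.inter_filter[symmetric]) auto
  have [measurable]: "(\<lambda>p. real (card {j \<in> {1..m} - {i}. p j \<le> s}))
    \<in> borel_measurable (Pi\<^sub>M ({1..m} - {i}) (\<lambda>_. borel))" for s :: real
    unfolding *
  proof (intro borel_measurable_sum measurable_If borel_measurable_const)
    fix j assume j: "j \<in> {1..m} - {i}"
    show "{p \<in> space (Pi\<^sub>M ({1..m} - {i}) (\<lambda>_. borel)). p j \<le> s} \<in> sets (Pi\<^sub>M ({1..m} - {i}) (\<lambda>_. borel))"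
      by (intro borel_measurable_le borel_measurable_const measurable_component_singleton j)
  qed
  have "last_hit m i \<delta> p k \<longleftrightarrow> real k \<le> 1 + real (card {j \<in> {1..m} - {i}. p j \<le> real k * \<delta>}) \<and>
     (\<forall>l\<in>{k<..m}. 1 + real (card {j \<in> {1..m} - {i}. p j \<le> real l * \<delta>}) < real l)" for p
    unfolding last_hit_def by (intro conj_cong ball_cong refl) linarith+
  then show ?thesis by simp measurable
qed

text \<open>A generalisation of the inequalities of Daniels and Simes. For fixed \<open>i\<close>, the events
  \<open>last_hit m i \<delta> p k\<close> are disjoint in \<open>k\<close> and independent of \<open>P i\<close>; the weight \<open>1 / k\<close> cancels the
  \<open>k\<close> in the bound for \<open>P i \<le> k \<delta>\<close>. So each \<open>i\<close> contributes at most \<open>c \<delta>\<close>.\<close>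

lemma crossing_prob_le:
  fixes \<delta> c :: real
  assumes "0 \<le> \<delta>" "0 \<le> c" and bound: "\<And>i k. i \<in> {1..m} \<Longrightarrow> k \<in> {1..m} \<Longrightarrow>
      prob {\<omega> \<in> space M. P i \<omega> \<le> real k * \<delta>} \<le> c * (real k * \<delta>)"
  shows "prob {\<omega> \<in> space M. \<exists>k\<in>{1..m}. k \<le> num_le m (pvals \<omega>) (real k * \<delta>)} \<le> m * (c * \<delta>)"
proof -
  let ?E = "{\<omega> \<in> space M. \<exists>k\<in>{1..m}. k \<le> num_le m (pvals \<omega>) (real k * \<delta>)}"
  let ?L = "\<lambda>i k. {\<omega> \<in> space M. last_hit m i \<delta> (others i \<omega>) k}"
  let ?Q = "\<lambda>i k. {\<omega> \<in> space M. P i \<omega> \<le> real k * \<delta> \<and> last_hit m i \<delta> (others i \<omega>) k}"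
  have L_meas [measurable]: "?L i k \<in> events" for i k by measurable
  have Q_meas: "?Q i k \<in> events" if [measurable]: "i \<in> {1..m}" for i k by measurable
  have E_meas [measurable]: "?E \<in> events"
  proof -
    have [measurable]: "(\<lambda>\<omega>. real (num_le m (pvals \<omega>) s)) \<in> borel_measurable M" for s
      using measurable_compose[OF pvals_measurable num_le_measurable[of "\<lambda>_. s"]] by simp
    have "{\<omega> \<in> space M. \<exists>k\<in>{1..m}. real k \<le> real (num_le m (pvals \<omega>) (real k * \<delta>))} \<in> events" by measurable
    then show ?thesis by simp
  qed
  have indep: "prob (?Q i k) = prob {\<omega> \<in> space M. P i \<omega> \<le> real k * \<delta>} * prob (?L i k)"
    if i [measurable]: "i \<in> {1..m}" for i k
  proof -
    let ?R = "Pi\<^sub>M ({1..m} - {i}) (\<lambda>_. borel) :: (nat \<Rightarrow> real) measure"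
    have Lp: "Measurable.pred ((borel \<Otimes>\<^sub>M count_space (UNIV :: bool set)) \<Otimes>\<^sub>M ?R) (\<lambda>z. last_hit m i \<delta> (snd z) k)"
      by measurable
    have "emeasure M (?Q i k) = (\<integral>\<^sup>+\<omega>. indicator (?Q i k) \<omega> \<partial>M)" using Q_meas[OF i] by simp
    also have "\<dots> = (\<integral>\<^sup>+\<omega>. (\<lambda>z. indicator {z. fst (fst z) \<le> real k * \<delta> \<and> last_hit m i \<delta> (snd z) k} z)
        ((P i \<omega>, H i \<omega>), others i \<omega>) \<partial>M)"
      by (intro nn_integral_cong) (auto simp: indicator_def)
    also have "\<dots> = (\<integral>\<^sup>+\<omega>'. (\<integral>\<^sup>+\<omega>. (\<lambda>z. indicator {z. fst (fst z) \<le> real k * \<delta> \<and> last_hit m i \<delta> (snd z) k} z)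
        ((P i \<omega>, H i \<omega>), others i \<omega>') \<partial>M) \<partial>M)"
    proof (rule nn_integral_split_coordinate[OF i])
      have "Measurable.pred ((borel \<Otimes>\<^sub>M count_space (UNIV :: bool set)) \<Otimes>\<^sub>M ?R)
        (\<lambda>z. fst (fst z) \<le> real k * \<delta> \<and> last_hit m i \<delta> (snd z) k)" using Lp by measurable
      then show "(\<lambda>z. indicator {z. fst (fst z) \<le> real k * \<delta> \<and> last_hit m i \<delta> (snd z) k} z :: ennreal)
        \<in> borel_measurable ((borel \<Otimes>\<^sub>M count_space (UNIV :: bool set)) \<Otimes>\<^sub>M ?R)" by measurable
    qed
    also have "\<dots> = (\<integral>\<^sup>+\<omega>'. emeasure M {\<omega> \<in> space M. P i \<omega> \<le> real k * \<delta>} * indicator (?L i k) \<omega>' \<partial>M)"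
    proof (rule nn_integral_cong)
      fix \<omega>' assume "\<omega>' \<in> space M"
      have "(\<integral>\<^sup>+\<omega>. indicator {z. fst (fst z) \<le> real k * \<delta> \<and> last_hit m i \<delta> (snd z) k} ((P i \<omega>, H i \<omega>), others i \<omega>') \<partial>M)
        = (\<integral>\<^sup>+\<omega>. indicator {\<omega> \<in> space M. P i \<omega> \<le> real k * \<delta>} \<omega> * indicator (?L i k) \<omega>' \<partial>M)"
        using \<open>\<omega>' \<in> space M\<close> by (intro nn_integral_cong) (auto simp: indicator_def)
      also have "\<dots> = emeasure M {\<omega> \<in> space M. P i \<omega> \<le> real k * \<delta>} * indicator (?L i k) \<omega>'"
        by (simp add: nn_integral_multc)
      finally show "(\<integral>\<^sup>+\<omega>. (\<lambda>z. indicator {z. fst (fst z) \<le> real k * \<delta> \<and> last_hit m i \<delta> (snd z) k} z)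
        ((P i \<omega>, H i \<omega>), others i \<omega>') \<partial>M) = emeasure M {\<omega> \<in> space M. P i \<omega> \<le> real k * \<delta>} * indicator (?L i k) \<omega>'" .
    qed
    also have "\<dots> = emeasure M {\<omega> \<in> space M. P i \<omega> \<le> real k * \<delta>} * emeasure M (?L i k)"
      using L_meas by (simp add: nn_integral_cmult)
    finally show ?thesis by (simp add: emeasure_eq_measure ennreal_mult[symmetric])
  qed
  have disjoint: "(\<Sum>k=1..m. prob (?L i k)) \<le> 1" for i
  proof -
    have "(\<Sum>k=1..m. prob (?L i k)) = prob (\<Union>k\<in>{1..m}. ?L i k)"
      using L_meas by (intro finite_measure_finite_Union[symmetric])
        (auto simp: disjoint_family_on_def dest: last_hit_unique)
    then show ?thesis by simp
  qed
  have Q_int: "integrable M (indicator (?Q i k) :: 'a \<Rightarrow> real)" if "i \<in> {1..m}" for i k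
    by (intro integrable_real_indicator Q_meas that) (simp add: emeasure_eq_measure)
  have "prob ?E = expectation (indicator ?E)" by simp
  also have "\<dots> \<le> expectation (\<lambda>\<omega>. \<Sum>i=1..m. \<Sum>k=1..m. indicator (?Q i k) \<omega> / real k)"
  proof (rule integral_mono)
    show "integrable M (indicator ?E :: 'a \<Rightarrow> real)"
      by (intro integrable_real_indicator E_meas) (simp add: emeasure_eq_measure)
    show "integrable M (\<lambda>\<omega>. \<Sum>i=1..m. \<Sum>k=1..m. indicator (?Q i k) \<omega> / real k)"
      by (intro Bochner_Integration.integrable_sum integrable_divide Q_int)
    fix \<omega> assume \<omega>: "\<omega> \<in> space M"
    have same: "last_hit m i \<delta> (pvals \<omega>) k = last_hit m i \<delta> (others i \<omega>) k" for i k
    proof -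
      have "{j \<in> {1..m} - {i}. pvals \<omega> j \<le> s} = {j \<in> {1..m} - {i}. others i \<omega> j \<le> s}" for s by auto
      then show ?thesis unfolding last_hit_def by simp
    qed
    have "indicator ?E \<omega> \<le> (\<Sum>i=1..m. \<Sum>k=1..m.
      of_bool (pvals \<omega> i \<le> real k * \<delta> \<and> last_hit m i \<delta> (pvals \<omega>) k) / real k)"
    proof (cases "\<omega> \<in> ?E")
      case True
      then have "\<exists>k\<in>{1..m}. k \<le> num_le m (pvals \<omega>) (real k * \<delta>)" by blast
      from crossing_le_sum_last_hit[OF \<open>0 \<le> \<delta>\<close> this] True
      show ?thesis by (simp only: indicator_simps)
    next
      case False
      then show ?thesis by (auto intro!: sum_nonneg)
    qed
    also have "\<dots> = (\<Sum>i=1..m. \<Sum>k=1..m. indicator (?Q i k) \<omega> / real k)"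
      unfolding same using \<omega> by (intro sum.cong) (auto simp: indicator_def)
    finally show "indicator ?E \<omega> \<le> (\<Sum>i=1..m. \<Sum>k=1..m. indicator (?Q i k) \<omega> / real k)" .
  qed
  also have "\<dots> = (\<Sum>i=1..m. \<Sum>k=1..m. prob (?Q i k) / real k)"
    using Q_int Q_meas
    by (simp add: Bochner_Integration.integral_sum Bochner_Integration.integrable_sum del: atLeastAtMost_iff)
  also have "\<dots> \<le> (\<Sum>i=1..m. \<Sum>k=1..m. c * \<delta> * prob (?L i k))"
  proof (intro sum_mono)
    fix i k assume ik: "i \<in> {1..m}" "k \<in> {1..m}"
    have "prob (?Q i k) / real k \<le> c * (real k * \<delta>) * prob (?L i k) / real k"
      unfolding indep[OF ik(1)] using bound[OF ik] by (intro divide_right_mono mult_right_mono) auto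
    also have "\<dots> = c * \<delta> * prob (?L i k)" using ik by simp
    finally show "prob (?Q i k) / real k \<le> c * \<delta> * prob (?L i k)" .
  qed
  also have "\<dots> = (\<Sum>i=1..m. c * \<delta> * (\<Sum>k=1..m. prob (?L i k)))" by (simp add: sum_distrib_left)
  also have "\<dots> \<le> (\<Sum>i=1..m. c * \<delta> * 1)"
    using disjoint assms(1,2) by (intro sum_mono mult_left_mono) auto
  also have "\<dots> = m * (c * \<delta>)" by simp
  finally show ?thesis .
qed

end

section \<open>Bounds for a fixed sample size\<close>

text \<open>The two estimates of \<open>G\<close> share everything that is needed below: they are nonnegative, lie below
  every concave majorant of the empirical distribution function, and have a measurable threshold.\<close>

definition cdf_estimator :: "(nat \<Rightarrow> (nat \<Rightarrow> real) \<Rightarrow> real \<Rightarrow> real) \<Rightarrow> bool" where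
  "cdf_estimator Ghat \<longleftrightarrow> Ghat = empirical_cdf \<or>
     Ghat = (\<lambda>m p. least_concave_majorant (empirical_cdf m p))"

lemma cdf_estimator_nonneg:
  assumes "cdf_estimator Ghat"
  shows "\<forall>t\<in>{0..1}. 0 \<le> Ghat m p t"
proof
  fix t :: real assume t: "t \<in> {0..1}"
  have "0 \<le> empirical_cdf m p t" by (rule empirical_cdf_range)
  also have "\<dots> \<le> least_concave_majorant (empirical_cdf m p) t"
    by (rule least_concave_majorant_ge[where c = 1]) (use t empirical_cdf_range in auto)
  finally show "0 \<le> Ghat m p t"
    using assms empirical_cdf_range(1) unfolding cdf_estimator_def by auto
qed

lemma cdf_estimator_le:
  assumes "cdf_estimator Ghat" "concave_on {0..1} h" "\<forall>s\<in>{0..1}. empirical_cdf m p s \<le> h s"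
  shows "\<forall>t\<in>{0..1}. Ghat m p t \<le> h t"
  using assms(1) least_concave_majorant_le[OF assms(2,3)] assms(3)
  unfolding cdf_estimator_def by auto

lemma cdf_estimator_restrict:
  "cdf_estimator Ghat \<Longrightarrow> Ghat m (\<lambda>i\<in>{1..m}. p i) = Ghat m p"
  unfolding cdf_estimator_def using empirical_cdf_restrict[of m p] by auto

lemma measurable_threshold:
  fixes e :: "(nat \<Rightarrow> real) \<Rightarrow> real"
  assumes "cdf_estimator Ghat" "0 < \<alpha>" "m \<ge> 1" "e \<in> borel_measurable (Pi\<^sub>M {1..m} (\<lambda>_. borel))"
    and "\<And>p. p \<in> space (Pi\<^sub>M {1..m} (\<lambda>_. borel)) \<Longrightarrow> e p \<le> 1"
  shows "(\<lambda>p. threshold \<alpha> (e p) (Ghat m p)) \<in> borel_measurable (Pi\<^sub>M {1..m} (\<lambda>_. borel))"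
  using assms(1) measurable_threshold_empirical[OF assms(2-5)] measurable_threshold_majorant[OF assms(2,4,5)]
  unfolding cdf_estimator_def by auto

text \<open>If the empirical distribution function stays below the line of slope \<open>(1 - b) / \<alpha>\<close>, then so does
  its least concave majorant, because a line is concave. As \<open>b' < b\<close>, the threshold is then \<open>0\<close>, where
  nothing is rejected.\<close>

lemma crossing_if_rejection:
  fixes \<alpha> b b' :: real
  assumes Ghat: "cdf_estimator Ghat" and "0 < \<alpha>" "m \<ge> 1" "b' < b" "b < 1"
    and rejection: "0 < num_le m p (threshold \<alpha> b' (Ghat m p))"
  shows "\<exists>k\<in>{1..m}. k \<le> num_le m p (real k * (\<alpha> / ((1 - b) * m)))"
proof (rule ccontr)
  assume no_crossing: "\<not> ?thesis"
  let ?T = "threshold \<alpha> b' (Ghat m p)" and ?K = "empirical_cdf m p"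
  have below: "\<forall>t\<in>{0..1}. ?K t \<le> 0 + (1 - b) / \<alpha> * t"
  proof (intro ballI leI notI)
    fix t :: real assume t: "t \<in> {0..1}" and less: "0 + (1 - b) / \<alpha> * t < ?K t"
    let ?r = "num_le m p t"
    have "0 \<le> (1 - b) / \<alpha> * t" using t assms by auto
    with less have "0 < ?K t" by linarith
    then have "?r \<in> {1..m}" using num_le_bound[of m p t] \<open>m \<ge> 1\<close>
      by (auto simp: empirical_cdf_num_le zero_less_divide_iff)
    moreover have "t \<le> real ?r * (\<alpha> / ((1 - b) * m))"
      using less assms by (simp add: empirical_cdf_num_le field_simps)
    then have "?r \<le> num_le m p (real ?r * (\<alpha> / ((1 - b) * m)))" by (rule num_le_mono)
    ultimately show False using no_crossing by blast
  qed
  have "(1 - b') * ?T \<le> \<alpha> * (0 + (1 - b) / \<alpha> * ?T)"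
    by (rule threshold_le_majorant)
       (use assms cdf_estimator_nonneg[OF Ghat] cdf_estimator_le[OF Ghat concave_on_affine below] in
        \<open>auto intro!: continuous_intros\<close>)
  moreover have "\<alpha> * (0 + (1 - b) / \<alpha> * ?T) = (1 - b) * ?T" using \<open>0 < \<alpha>\<close> by simp
  ultimately have "(b - b') * ?T \<le> 0" by (simp add: algebra_simps)
  moreover have "0 \<le> ?T"
    by (rule threshold_range) (use assms cdf_estimator_nonneg[OF Ghat] in auto)
  ultimately have "?T = 0" using \<open>b' < b\<close> by (simp add: mult_le_0_iff)
  moreover have "?K 0 \<le> 0" using below by force
  then have "num_le m p 0 = 0" using \<open>m \<ge> 1\<close> by (simp add: empirical_cdf_num_le divide_le_0_iff)
  ultimately show False using rejection by simp
qed

context two_groups_sample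
begin

lemma expectation_le_split:
  assumes [measurable]: "X \<in> borel_measurable M" and X: "\<And>\<omega>. 0 \<le> X \<omega>" "\<And>\<omega>. X \<omega> \<le> 1"
    and [measurable]: "B \<in> events" "A \<in> events" "D \<in> events"
    and split: "\<And>\<omega>. \<omega> \<in> space M - B - A \<Longrightarrow> X \<omega> \<le> c * indicator D \<omega>"
    and "0 \<le> c"
  shows "expectation X \<le> expectation (\<lambda>\<omega>. X \<omega> * indicator A \<omega>) + c * prob D + prob B"
proof -
  have int: "integrable M (indicator S :: 'a \<Rightarrow> real)" if "S \<in> events" for S
    using that by (intro integrable_real_indicator) (simp_all add: emeasure_eq_measure)
  have intX: "integrable M (\<lambda>\<omega>. X \<omega> * indicator A \<omega>)"
    by (intro integrable_const_bound[of _ 1] AE_I2) (use X in \<open>auto simp: indicator_def\<close>)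
  have "expectation X \<le> expectation (\<lambda>\<omega>. X \<omega> * indicator A \<omega> + c * indicator D \<omega> + indicator B \<omega>)"
  proof (rule integral_mono)
    show "integrable M X" by (intro integrable_const_bound[of _ 1] AE_I2) (use X in auto)
    show "integrable M (\<lambda>\<omega>. X \<omega> * indicator A \<omega> + c * indicator D \<omega> + indicator B \<omega>)"
      by (intro Bochner_Integration.integrable_add integrable_mult_right int intX) simp_all
    fix \<omega> assume \<omega>: "\<omega> \<in> space M"
    have "0 \<le> c * indicator D \<omega>" using \<open>0 \<le> c\<close> by simp
    then show "X \<omega> \<le> X \<omega> * indicator A \<omega> + c * indicator D \<omega> + indicator B \<omega>"
      using X[of \<omega>] split[of \<omega>] \<omega> by (cases "\<omega> \<in> A"; cases "\<omega> \<in> B") (auto intro: order_trans)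
  qed
  also have "\<dots> = expectation (\<lambda>\<omega>. X \<omega> * indicator A \<omega>) + c * prob D + prob B"
    using int intX by (simp add: Bochner_Integration.integral_add)
  finally show ?thesis .
qed

text \<open>The common setting of the two cases. Off the bad event \<open>B\<close>, the estimator is below \<open>b\<close> and the
  counts are \<open>\<eta>\<close>-close to their means, where \<open>\<eta>\<close> is small compared with the gap \<open>(a - b) \<epsilon>\<close>. The
  number \<open>\<gamma>\<close> bounds the density from below near the origin; the two cases differ in how large
  \<open>\<gamma>\<close> is.\<close>

context
  fixes \<alpha> b \<eta> \<epsilon> \<gamma> :: real and e :: "(nat \<Rightarrow> real) \<Rightarrow> real"
    and Ghat :: "nat \<Rightarrow> (nat \<Rightarrow> real) \<Rightarrow> real \<Rightarrow> real" and B :: "'a set" and \<tau> :: "(nat \<Rightarrow> real) \<Rightarrow> real"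
  assumes concave: "concave_on {0..1} G" and Ghat: "cdf_estimator Ghat"
    and alpha: "0 < \<alpha>" "\<alpha> < 1" and m: "m \<ge> 1" and b: "b < a"
    and e_measurable [measurable]: "e \<in> borel_measurable (Pi\<^sub>M {1..m} (\<lambda>_. borel))"
    and e_le: "\<And>p. p \<in> space (Pi\<^sub>M {1..m} (\<lambda>_. borel)) \<Longrightarrow> e p \<le> 1"
    and \<epsilon>: "0 < \<epsilon>" "\<epsilon> < 1" and \<eta>: "0 < \<eta>" "3 * \<eta> \<le> (a - b) * \<epsilon>"
    and dens: "AE x in lborel. x \<in> {0<..\<epsilon>} \<longrightarrow> \<gamma> \<le> g x"
    and B_events: "B \<in> events"
    and good_e: "\<And>\<omega>. \<omega> \<in> space M - B \<Longrightarrow> e (pvals \<omega>) < b"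
    and good_count: "\<And>\<omega> t. \<omega> \<in> space M - B \<Longrightarrow> t \<in> {0..1} \<Longrightarrow>
      \<bar>real (num_le m (pvals \<omega>) t) / m - G t\<bar> \<le> \<eta>"
  defines "\<tau> \<equiv> \<lambda>p. threshold \<alpha> (e p) (Ghat m p)"
begin

lemma \<tau>_measurable: "\<tau> \<in> borel_measurable (Pi\<^sub>M {1..m} (\<lambda>_. borel))"
  unfolding \<tau>_def by (rule measurable_threshold[OF Ghat alpha(1) m e_measurable e_le])

text \<open>On the good event \<open>G + \<eta>\<close> is a concave majorant of the empirical distribution function, hence of
  either estimate of \<open>G\<close>.\<close>

lemma good_threshold:
  assumes \<omega>: "\<omega> \<in> space M - B"
  defines "t \<equiv> \<tau> (pvals \<omega>)"
  shows "0 \<le> t" "t \<le> 1" "(1 - b) * t \<le> \<alpha> * (G t + \<eta>)"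
proof -
  let ?p = "pvals \<omega>"
  have e1: "e ?p \<le> 1" using \<omega> by (intro e_le measurable_space[OF pvals_measurable]) simp
  note range = threshold_range[OF alpha(1) e1 cdf_estimator_nonneg[OF Ghat], of m ?p]
  show t: "0 \<le> t" "t \<le> 1" using range by (simp_all add: t_def \<tau>_def)
  have majorant: "\<forall>s\<in>{0..1}. empirical_cdf m ?p s \<le> G s + \<eta>"
    using good_count[OF \<omega>] by (fastforce simp: empirical_cdf_num_le abs_le_iff)
  have "concave_on {0..1} (\<lambda>s. G s + \<eta>)"
    by (intro concave_on_add concave) (simp add: concave_on_const)
  from cdf_estimator_le[OF Ghat this majorant]
  have "(1 - e ?p) * t \<le> \<alpha> * (G t + \<eta>)"
    unfolding t_def \<tau>_def
    by (intro threshold_le_majorant[OF alpha(1) e1 cdf_estimator_nonneg[OF Ghat]]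
        continuous_intros continuous_on_mixture_cdf)
  moreover have "(1 - b) * t \<le> (1 - e ?p) * t"
    using good_e[OF \<omega>] t by (intro mult_right_mono) auto
  ultimately show "(1 - b) * t \<le> \<alpha> * (G t + \<eta>)" by linarith
qed

text \<open>Case of a local false discovery rate at most \<open>\<alpha>\<close> near the origin. The events \<open>\<tau> \<le> \<epsilon>\<close> and
  \<open>\<tau> > \<epsilon>\<close> each contribute at most \<open>\<alpha>\<close> times their probability.\<close>

lemma expectation_fdp_le_density_large:
  assumes density: "1 - a \<le> \<alpha> * \<gamma>"
    and good_null: "\<And>\<omega> t. \<omega> \<in> space M - B \<Longrightarrow> t \<in> {0..1} \<Longrightarrow>
      \<bar>(\<Sum>i=1..m. of_bool (P i \<omega> \<le> t \<and> \<not> H i \<omega>)) / m - (1 - a) * t\<bar> \<le> \<eta>"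
  shows "expectation (\<lambda>\<omega>. fdp m (\<lambda>i. P i \<omega>) (\<lambda>i. H i \<omega>) (\<tau> (pvals \<omega>))) \<le> \<alpha> + prob B"
proof -
  let ?X = "\<lambda>\<omega>. fdp m (\<lambda>i. P i \<omega>) (\<lambda>i. H i \<omega>) (\<tau> (pvals \<omega>))"
  let ?Pi = "Pi\<^sub>M {1..m} (\<lambda>_. borel) :: (nat \<Rightarrow> real) measure"
  let ?small = "{p \<in> space ?Pi. \<tau> p \<le> \<epsilon>}"
  let ?A = "{\<omega> \<in> space M. \<tau> (pvals \<omega>) \<le> \<epsilon>}" and ?D = "{\<omega> \<in> space M. \<not> \<tau> (pvals \<omega>) \<le> \<epsilon>}"
  note [measurable] = \<tau>_measurable
  have small [measurable]: "?small \<in> sets ?Pi" by measurable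
  have A [measurable]: "?A \<in> events" by measurable
  have D [measurable]: "?D \<in> events" by measurable
  have "?X \<omega> \<le> \<alpha> * indicator ?D \<omega>" if \<omega>: "\<omega> \<in> space M - B - ?A" for \<omega>
  proof -
    let ?t = "\<tau> (pvals \<omega>)"
    let ?V = "\<Sum>i=1..m. of_bool (P i \<omega> \<le> ?t \<and> \<not> H i \<omega>) :: real" and ?R = "real (num_le m (pvals \<omega>) ?t)"
    have \<omega>': "\<omega> \<in> space M - B" and t: "\<epsilon> < ?t" using \<omega> by auto
    note thr = good_threshold[OF \<omega>']
    have "?V / m \<le> (1 - a) * ?t + \<eta>" using good_null[OF \<omega>', of ?t] thr by (simp add: abs_le_iff)
    moreover have "(a - b) * \<epsilon> \<le> (a - b) * ?t" using b t by (intro mult_left_mono) auto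
    then have "(1 - a) * ?t + 3 * \<eta> \<le> (1 - b) * ?t" using \<eta>(2) by (simp add: algebra_simps)
    moreover have "G ?t \<le> ?R / m + \<eta>" using good_count[OF \<omega>', of ?t] thr by (simp add: abs_le_iff)
    then have "\<alpha> * (G ?t + \<eta>) \<le> \<alpha> * (?R / m + 2 * \<eta>)" using alpha by (intro mult_left_mono) auto
    moreover have "\<alpha> * \<eta> \<le> 1 * \<eta>" using alpha \<eta>(1) by (intro mult_right_mono) auto
    ultimately have "?V / m \<le> \<alpha> * (?R / m)" using thr(3) by (simp add: distrib_left)
    then have "?V \<le> \<alpha> * ?R" using m by (simp add: field_simps)
    then have "?X \<omega> \<le> \<alpha>"
      unfolding fdp_eq num_le_pvals[symmetric] using alpha
      by (cases "?R = 0") (simp_all add: divide_le_eq)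
    then show ?thesis using \<omega> by (simp add: indicator_def)
  qed
  with fdp_range fdp_measurable[OF \<tau>_measurable] B_events A D alpha(1)
  have "expectation ?X \<le> expectation (\<lambda>\<omega>. ?X \<omega> * indicator ?A \<omega>) + \<alpha> * prob ?D + prob B"
    by (intro expectation_le_split) auto
  also have "expectation (\<lambda>\<omega>. ?X \<omega> * indicator ?A \<omega>) = expectation (\<lambda>\<omega>. ?X \<omega> * indicator ?small (pvals \<omega>))"
    using measurable_space[OF pvals_measurable]
    by (intro Bochner_Integration.integral_cong) (auto simp: indicator_def)
  also have "\<dots> \<le> \<alpha> * prob {\<omega> \<in> space M. pvals \<omega> \<in> ?small \<and> 0 < num_le m (pvals \<omega>) (\<tau> (pvals \<omega>))}"
    using alpha by (intro expectation_fdp_le_rejection_prob[OF concave \<tau>_measurable small _ \<epsilon>(2) dens _ density]) auto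
  also have "\<dots> \<le> \<alpha> * prob ?A"
    using alpha A by (intro mult_left_mono finite_measure_mono) auto
  finally have "expectation ?X \<le> \<alpha> * (prob ?A + prob ?D) + prob B" by (simp add: distrib_left)
  also have "prob ?A + prob ?D = 1" using prob_neg[of "\<lambda>\<omega>. \<tau> (pvals \<omega>) \<le> \<epsilon>"] A by simp
  finally show ?thesis by simp
qed

text \<open>Case of a threshold tending to \<open>0\<close>. On the good event \<open>(a - b) \<tau> \<le> \<alpha> \<eta>\<close>, hence \<open>\<tau> \<le> \<epsilon>\<close>; what
  remains is the local rate \<open>c\<close> times the probability of a crossing, which is at most
  \<open>c g0 \<alpha> / (1 - b)\<close>.\<close>

lemma expectation_fdp_le_density_small:
  fixes g0 c :: real
  assumes subcritical: "\<And>t. t \<in> {0..1} \<Longrightarrow> \<alpha> * G t \<le> (1 - a) * t"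
    and g0: "1 \<le> g0" "\<And>t. t \<in> {0..1} \<Longrightarrow> G t \<le> g0 * t"
    and c: "0 \<le> c" "1 - a \<le> c * \<gamma>" "c * g0 \<le> 1 - b"
  shows "expectation (\<lambda>\<omega>. fdp m (\<lambda>i. P i \<omega>) (\<lambda>i. H i \<omega>) (\<tau> (pvals \<omega>))) \<le> \<alpha> + prob B"
proof -
  let ?X = "\<lambda>\<omega>. fdp m (\<lambda>i. P i \<omega>) (\<lambda>i. H i \<omega>) (\<tau> (pvals \<omega>))"
  let ?Pi = "Pi\<^sub>M {1..m} (\<lambda>_. borel) :: (nat \<Rightarrow> real) measure"
  let ?small = "{p \<in> space ?Pi. \<tau> p \<le> \<epsilon> \<and> e p < b}"
  let ?A = "{\<omega> \<in> space M. \<tau> (pvals \<omega>) \<le> \<epsilon> \<and> e (pvals \<omega>) < b}"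
  let ?\<delta> = "\<alpha> / ((1 - b) * m)"
  let ?C = "{\<omega> \<in> space M. \<exists>k\<in>{1..m}. k \<le> num_le m (pvals \<omega>) (real k * ?\<delta>)}"
  note [measurable] = \<tau>_measurable
  have b1: "b < 1" using b a_le_1 by simp
  have small [measurable]: "?small \<in> sets ?Pi" by measurable
  have A [measurable]: "?A \<in> events" by measurable
  have C [measurable]: "?C \<in> events"
  proof -
    have [measurable]: "(\<lambda>\<omega>. real (num_le m (pvals \<omega>) s)) \<in> borel_measurable M" for s
      using measurable_compose[OF pvals_measurable num_le_measurable[of "\<lambda>_. s"]] by simp
    have "{\<omega> \<in> space M. \<exists>k\<in>{1..m}. real k \<le> real (num_le m (pvals \<omega>) (real k * ?\<delta>))} \<in> events" by measurable
    then show ?thesis by simp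
  qed
  have "?X \<omega> \<le> 0 * indicator {} \<omega>" if \<omega>: "\<omega> \<in> space M - B - ?A" for \<omega>
  proof -
    let ?t = "\<tau> (pvals \<omega>)"
    have \<omega>': "\<omega> \<in> space M - B" using \<omega> by auto
    note thr = good_threshold[OF \<omega>']
    have "(1 - b) * ?t \<le> (1 - a) * ?t + \<alpha> * \<eta>"
      using thr(3) subcritical[of ?t] thr(1,2) by (simp add: distrib_left)
    then have "(a - b) * ?t \<le> \<alpha> * \<eta>" by (simp add: algebra_simps)
    also have "\<alpha> * \<eta> \<le> 3 * \<eta>" using alpha \<eta>(1) by (intro mult_right_mono) auto
    also note \<eta>(2)
    finally have "?t \<le> \<epsilon>" using b by simp
    then show ?thesis using \<omega> good_e[OF \<omega>'] by auto
  qed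
  with fdp_range fdp_measurable[OF \<tau>_measurable] B_events A
  have "expectation ?X \<le> expectation (\<lambda>\<omega>. ?X \<omega> * indicator ?A \<omega>) + 0 * prob {} + prob B"
    by (intro expectation_le_split) auto
  also have "expectation (\<lambda>\<omega>. ?X \<omega> * indicator ?A \<omega>) = expectation (\<lambda>\<omega>. ?X \<omega> * indicator ?small (pvals \<omega>))"
    using measurable_space[OF pvals_measurable]
    by (intro Bochner_Integration.integral_cong) (auto simp: indicator_def)
  also have "\<dots> \<le> c * prob {\<omega> \<in> space M. pvals \<omega> \<in> ?small \<and> 0 < num_le m (pvals \<omega>) (\<tau> (pvals \<omega>))}"
    by (intro expectation_fdp_le_rejection_prob[OF concave \<tau>_measurable small _ \<epsilon>(2) dens c(1,2)]) auto
  also have "\<dots> \<le> c * prob ?C"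
    using c(1) C crossing_if_rejection[OF Ghat alpha(1) m _ b1]
    by (intro mult_left_mono finite_measure_mono) (auto simp: \<tau>_def)
  also have "prob ?C \<le> m * (g0 * ?\<delta>)"
  proof (rule crossing_prob_le)
    fix i k assume ik: "i \<in> {1..m}" "k \<in> {1..m}"
    let ?t = "real k * ?\<delta>"
    have t0: "0 \<le> ?t" using alpha b1 by simp
    show "prob {\<omega> \<in> space M. P i \<omega> \<le> ?t} \<le> g0 * ?t"
    proof (cases "?t \<le> 1")
      case True
      with t0 have t: "?t \<in> {0..1}" by simp
      show ?thesis unfolding prob_le[OF ik(1) t] by (rule g0(2)[OF t])
    next
      case False
      \<comment> \<open>Critical values may exceed \<open>1\<close>, where the bound is trivial.\<close>
      then have "1 * 1 \<le> g0 * ?t" using g0(1) by (intro mult_mono) auto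
      then show ?thesis using order_trans[OF prob_le_1] by simp
    qed
  qed (use alpha b1 g0 in auto)
  also have "c * (m * (g0 * ?\<delta>)) = (c * g0) * (\<alpha> / (1 - b))"
    using m by simp
  also have "\<dots> \<le> (1 - b) * (\<alpha> / (1 - b))"
    using c(3) alpha b1 by (intro mult_right_mono) auto
  also have "\<dots> = \<alpha>" using b1 by simp
  finally show ?thesis using c(1) by (simp add: mult_left_mono)
qed

end
end

section \<open>Asymptotic control of the false discovery rate\<close>

context two_groups
begin

text \<open>In the second regime \<open>g0 = sup G t / t\<close> is finite and \<open>\<gamma> = g0 (1 - a) / (1 - b)\<close> is strictly smaller,
  because \<open>b < a\<close>. So \<open>\<gamma>\<close> is a lower bound for the density near the origin, and the choice
  \<open>c = (1 - b) / g0\<close> meets both requirements with equality.\<close>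

lemma density_regimes:
  assumes concave: "concave_on {0..1} G" and alpha: "0 < \<alpha>" and b: "b < a"
  obtains (large) \<epsilon> \<gamma> where "0 < \<epsilon>" "\<epsilon> < 1" "AE x in lborel. x \<in> {0<..\<epsilon>} \<longrightarrow> \<gamma> \<le> g x"
      "1 - a \<le> \<alpha> * \<gamma>"
  | (small) \<epsilon> \<gamma> g0 c where "0 < \<epsilon>" "\<epsilon> < 1" "AE x in lborel. x \<in> {0<..\<epsilon>} \<longrightarrow> \<gamma> \<le> g x"
      "\<And>t. t \<in> {0..1} \<Longrightarrow> \<alpha> * G t \<le> (1 - a) * t"
      "1 \<le> g0" "\<And>t. t \<in> {0..1} \<Longrightarrow> G t \<le> g0 * t"
      "0 \<le> c" "1 - a \<le> c * \<gamma>" "c * g0 \<le> 1 - b"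
proof (cases "\<exists>t\<in>{0..1}. (1 - a) * t < \<alpha> * G t")
  case True
  then obtain t where t: "0 \<le> t" "t \<le> 1" "(1 - a) * t < \<alpha> * G t" by auto
  have "t \<noteq> 0" using t(3) mixture_cdf_0 by auto
  with t have "0 < t" by simp
  moreover have "(1 - a) / \<alpha> * t < G t" using t(3) alpha by (simp add: field_simps)
  moreover have "0 \<le> (1 - a) / \<alpha>" using a_le_1 alpha by simp
  ultimately obtain \<epsilon> where "0 < \<epsilon>" "\<epsilon> < 1" "AE x in lborel. x \<in> {0<..\<epsilon>} \<longrightarrow> (1 - a) / \<alpha> \<le> g x"
    using density_ge_near_0[OF concave _ t(2)] by blast
  then show thesis using alpha by (intro large[of \<epsilon> "(1 - a) / \<alpha>"]) auto
next
  case False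
  then have subcritical: "\<alpha> * G t \<le> (1 - a) * t" if "t \<in> {0..1}" for t
    using that by (force simp: not_less)
  define g0 where "g0 = (SUP t\<in>{0<..1}. G t / t)"
  have bdd: "bdd_above ((\<lambda>t. G t / t) ` {0<..1})"
  proof (rule bdd_aboveI2)
    fix t :: real assume "t \<in> {0<..1}"
    then show "G t / t \<le> (1 - a) / \<alpha>"
      using subcritical[of t] alpha by (simp add: field_simps)
  qed
  have ratio_le: "G t / t \<le> g0" if "t \<in> {0<..1}" for t
    unfolding g0_def using bdd that by (rule cSUP_upper2) simp
  have g0: "1 \<le> g0" using ratio_le[of 1] by (simp add: mixture_cdf_1)
  have G_le: "G t \<le> g0 * t" if "t \<in> {0..1}" for t
  proof (cases "t = 0")
    case False
    then show ?thesis using ratio_le[of t] that by (simp add: divide_le_eq)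
  qed (simp add: mixture_cdf_0)
  have "a < 1" using subcritical[of 1] alpha a_le_1 by (simp add: mixture_cdf_1)
  define \<gamma> where "\<gamma> = g0 * ((1 - a) / (1 - b))"
  have "\<gamma> < g0 * 1"
    unfolding \<gamma>_def using g0 b \<open>a < 1\<close> by (intro mult_strict_left_mono) auto
  then have "\<exists>t\<in>{0<..1}. \<gamma> < G t / t"
    unfolding g0_def using bdd by (simp add: less_cSUP_iff)
  then obtain t where t: "0 < t" "t \<le> 1" "\<gamma> < G t / t" by auto
  have "0 \<le> \<gamma>" unfolding \<gamma>_def using g0 b \<open>a < 1\<close> by simp
  moreover have "\<gamma> * t < G t" using t by (simp add: less_divide_eq)
  ultimately obtain \<epsilon> where \<epsilon>: "0 < \<epsilon>" "\<epsilon> < 1" "AE x in lborel. x \<in> {0<..\<epsilon>} \<longrightarrow> \<gamma> \<le> g x"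
    using density_ge_near_0[OF concave t(1,2)] by blast
  show thesis
  proof (rule small[OF \<epsilon> subcritical g0 G_le])
    show "0 \<le> (1 - b) / g0" "(1 - b) / g0 * g0 \<le> 1 - b" "1 - a \<le> (1 - b) / g0 * \<gamma>"
      unfolding \<gamma>_def using g0 b \<open>a < 1\<close> by auto
  qed
qed

end

theorem theorem5p2:
  fixes \<alpha> a a0 :: real
    and F g :: "real \<Rightarrow> real"
    and M :: "nat \<Rightarrow> 'a measure"
    and P :: "nat \<Rightarrow> nat \<Rightarrow> 'a \<Rightarrow> real"
    and H :: "nat \<Rightarrow> nat \<Rightarrow> 'a \<Rightarrow> bool"
    and est :: "nat \<Rightarrow> (nat \<Rightarrow> real) \<Rightarrow> real"
    and ahat :: "nat \<Rightarrow> 'a \<Rightarrow> real"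
    and Ghat :: "nat \<Rightarrow> (nat \<Rightarrow> real) \<Rightarrow> real \<Rightarrow> real"
    and T :: "nat \<Rightarrow> 'a \<Rightarrow> real"
  assumes alpha: "0 < \<alpha>" "\<alpha> < 1"
    and model: "\<And>m. m \<ge> 1 \<Longrightarrow> two_groups_sample a F g (M m) m (P m) (H m)"
    and G_concave: "concave_on {0..1} (mixture_cdf a F)"
    and Ghat: "Ghat = empirical_cdf \<or>
               Ghat = (\<lambda>m p. least_concave_majorant (empirical_cdf m p))"
    and est: "\<And>m. m \<ge> 1 \<Longrightarrow> is_estimator m (est m)"
    and ahat: "\<And>m \<omega>. ahat m \<omega> = est m (\<lambda>i\<in>{1..m}. P m i \<omega>)"
    and ahat_conv: "converges_in_prob M ahat a0"
    and a0: "a0 < a"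
    and T: "\<And>m \<omega>. T m \<omega> = threshold \<alpha> (ahat m \<omega>) (Ghat m (\<lambda>i. P m i \<omega>))"
  shows "\<exists>\<epsilon> :: nat \<Rightarrow> real. \<epsilon> \<in> o(\<lambda>_. 1) \<and>
           (\<forall>m\<ge>1. prob_space.expectation (M m)
                     (\<lambda>\<omega>. fdp m (\<lambda>i. P m i \<omega>) (\<lambda>i. H m i \<omega>) (T m \<omega>)) \<le> \<alpha> + \<epsilon> m)"
proof -
  interpret two_groups a F g using model[of 1] by (rule two_groups_sample.axioms(1)) simp
  have cdf_est: "cdf_estimator Ghat" using Ghat by (simp add: cdf_estimator_def)
  \<comment> \<open>Deviations of the estimator up to \<open>\<delta>\<close> keep it strictly below \<open>b\<close>.\<close>
  define \<delta> b where "\<delta> = (a - a0) / 3" and "b = a0 + 2 * \<delta>"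
  have "a = a0 + 3 * \<delta>" by (simp add: \<delta>_def field_simps)
  then have \<delta>: "0 < \<delta>" "b < a" "a0 + \<delta> < b" using a0 by (auto simp: b_def)
  have "\<exists>\<epsilon>>0. \<epsilon> < 1 \<and> (\<exists>\<gamma>. (AE x in lborel. x \<in> {0<..\<epsilon>} \<longrightarrow> \<gamma> \<le> g x) \<and> (1 - a \<le> \<alpha> * \<gamma> \<or>
      (\<exists>g0 c. (\<forall>t\<in>{0..1}. \<alpha> * G t \<le> (1 - a) * t) \<and> 1 \<le> g0 \<and> (\<forall>t\<in>{0..1}. G t \<le> g0 * t) \<and>
         0 \<le> c \<and> 1 - a \<le> c * \<gamma> \<and> c * g0 \<le> 1 - b)))"
    by (rule density_regimes[OF G_concave alpha(1) \<delta>(2)]) blast+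
  then obtain \<epsilon> \<gamma> where \<epsilon>: "0 < \<epsilon>" "\<epsilon> < 1"
    and dens: "AE x in lborel. x \<in> {0<..\<epsilon>} \<longrightarrow> \<gamma> \<le> g x"
    and regime: "1 - a \<le> \<alpha> * \<gamma> \<or>
      (\<exists>g0 c. (\<forall>t\<in>{0..1}. \<alpha> * G t \<le> (1 - a) * t) \<and> 1 \<le> g0 \<and> (\<forall>t\<in>{0..1}. G t \<le> g0 * t) \<and>
         0 \<le> c \<and> 1 - a \<le> c * \<gamma> \<and> c * g0 \<le> 1 - b)" by blast
  \<comment> \<open>Three errors of size \<open>\<eta>\<close> must fit into the gap \<open>(a - b) t\<close> for \<open>t > \<epsilon>\<close>.\<close>
  define \<eta> where "\<eta> = (a - b) * \<epsilon> / 3"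
  have \<eta>: "0 < \<eta>" "3 * \<eta> \<le> (a - b) * \<epsilon>" using \<epsilon> \<delta> by (auto simp: \<eta>_def)
  then have \<eta>2: "0 < \<eta> / 2" by simp
  obtain D1 where D1: "finite D1" "D1 \<subseteq> {0..1}"
    "\<And>t. t \<in> {0..1} \<Longrightarrow> \<exists>s\<in>D1. \<exists>u\<in>D1. s \<le> t \<and> t \<le> u \<and> G u - G s \<le> \<eta> / 2"
    using grid_of_small_oscillation[OF continuous_on_mixture_cdf \<eta>2] by blast
  have "continuous_on {0..1} (\<lambda>t. (1 - a) * t)" by (intro continuous_intros)
  from grid_of_small_oscillation[OF this \<eta>2] obtain D2 where D2: "finite D2" "D2 \<subseteq> {0..1}"
    "\<And>t. t \<in> {0..1} \<Longrightarrow> \<exists>s\<in>D2. \<exists>u\<in>D2. s \<le> t \<and> t \<le> u \<and> (1 - a) * u - (1 - a) * s \<le> \<eta> / 2"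
    by blast
  define tail where "tail m = 2 * exp (- 2 * (\<eta> / 2)\<^sup>2 * real m)" for m
  define miss where "miss m = {\<omega> \<in> space (M m). \<delta> < \<bar>ahat m \<omega> - a0\<bar>}" for m
  define r where "r m = real (card D1) * tail m + real (card D2) * tail m + measure (M m) (miss m)" for m
  have "tail \<longlonglongrightarrow> 0"
  proof -
    let ?q = "exp (- 2 * (\<eta> / 2)\<^sup>2)"
    have "(\<lambda>m. 2 * ?q ^ m) \<longlonglongrightarrow> 2 * 0"
      using \<eta> by (intro tendsto_mult tendsto_const LIMSEQ_realpow_zero) auto
    moreover have "tail = (\<lambda>m. 2 * ?q ^ m)"
      by (simp add: tail_def fun_eq_iff exp_of_nat_mult[symmetric] mult.commute)
    ultimately show ?thesis by simp
  qed
  moreover have "(\<lambda>m. measure (M m) (miss m)) \<longlonglongrightarrow> 0"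
    using ahat_conv \<delta>(1) unfolding converges_in_prob_def miss_def by blast
  ultimately have "r \<longlonglongrightarrow> real (card D1) * 0 + real (card D2) * 0 + 0"
    unfolding r_def by (intro tendsto_intros)
  then have "r \<in> o(\<lambda>_. 1)" by (intro smalloI_tendsto) auto
  moreover have "prob_space.expectation (M m)
      (\<lambda>\<omega>. fdp m (\<lambda>i. P m i \<omega>) (\<lambda>i. H m i \<omega>) (T m \<omega>)) \<le> \<alpha> + r m" if m: "m \<ge> 1" for m
  proof -
    interpret two_groups_sample a F g "M m" m "P m" "H m" by (rule model[OF m])
    let ?Pi = "Pi\<^sub>M {1..m} (\<lambda>_. borel) :: (nat \<Rightarrow> real) measure"
    have e_meas [measurable]: "est m \<in> borel_measurable ?Pi"
      using est[OF m] unfolding is_estimator_def measurable_restrict_space2_iff by simp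
    have e_range: "est m p \<le> 1" if "p \<in> space ?Pi" for p
      using est[OF m] that unfolding is_estimator_def measurable_restrict_space2_iff by auto
    have ahat': "ahat m \<omega> = est m (pvals \<omega>)" for \<omega> by (simp add: ahat pvals_def)
    have T': "T m \<omega> = threshold \<alpha> (est m (pvals \<omega>)) (Ghat m (pvals \<omega>))" for \<omega>
      unfolding T ahat' pvals_def using cdf_estimator_restrict[OF cdf_est] by simp
    have miss [measurable]: "miss m \<in> sets (M m)" unfolding miss_def ahat' by measurable
    obtain B1 where B1: "B1 \<in> events" "prob B1 \<le> real (card D1) * tail m"
      "\<And>\<omega> t. \<omega> \<in> space (M m) - B1 \<Longrightarrow> t \<in> {0..1} \<Longrightarrow>
        \<bar>(\<Sum>i=1..m. of_bool (P m i \<omega> \<le> t \<and> H m i \<omega> \<in> UNIV)) / m - G t\<bar> \<le> 2 * (\<eta> / 2)"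
      using uniform_deviation[OF m _ _ \<eta>2 D1, of UNIV] prob_le mixture_cdf_mono
      unfolding tail_def by auto
    obtain B2 where B2: "B2 \<in> events" "prob B2 \<le> real (card D2) * tail m"
      "\<And>\<omega> t. \<omega> \<in> space (M m) - B2 \<Longrightarrow> t \<in> {0..1} \<Longrightarrow>
        \<bar>(\<Sum>i=1..m. of_bool (P m i \<omega> \<le> t \<and> H m i \<omega> \<in> {False})) / m - (1 - a) * t\<bar> \<le> 2 * (\<eta> / 2)"
    proof -
      have law: "prob {\<omega> \<in> space (M m). P m i \<omega> \<le> t \<and> H m i \<omega> \<in> {False}} = (1 - a) * t"
        if "i \<in> {1..m}" "t \<in> {0..1}" for i t
        using prob_null_le[OF that] by simp
      have mono: "(1 - a) * s \<le> (1 - a) * t" if "s \<le> t" for s t :: real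
        using that a_le_1 by (intro mult_left_mono) auto
      from uniform_deviation[OF m law mono \<eta>2 D2] show thesis
        using that unfolding tail_def by blast
    qed
    define B where "B = B1 \<union> B2 \<union> miss m"
    have B: "B \<in> events" using B1(1) B2(1) miss by (simp add: B_def)
    have good_e: "est m (pvals \<omega>) < b" if "\<omega> \<in> space (M m) - B" for \<omega>
      using that \<delta> by (auto simp: B_def miss_def ahat')
    have good_count: "\<bar>real (num_le m (pvals \<omega>) t) / m - G t\<bar> \<le> \<eta>"
      if "\<omega> \<in> space (M m) - B" "t \<in> {0..1}" for \<omega> t
      using B1(3)[of \<omega> t] that by (simp add: B_def num_le_pvals num_le_sum)
    have good_null: "\<bar>(\<Sum>i=1..m. of_bool (P m i \<omega> \<le> t \<and> \<not> H m i \<omega>)) / m - (1 - a) * t\<bar> \<le> \<eta>"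
      if "\<omega> \<in> space (M m) - B" "t \<in> {0..1}" for \<omega> t
      using B2(3)[of \<omega> t] that by (simp add: B_def)
    note setting = G_concave cdf_est alpha m \<delta>(2) e_meas e_range \<epsilon> \<eta> dens B good_e good_count
    have "expectation (\<lambda>\<omega>. fdp m (\<lambda>i. P m i \<omega>) (\<lambda>i. H m i \<omega>)
        (threshold \<alpha> (est m (pvals \<omega>)) (Ghat m (pvals \<omega>)))) \<le> \<alpha> + prob B"
      using regime
    proof
      assume "1 - a \<le> \<alpha> * \<gamma>"
      from expectation_fdp_le_density_large[OF setting this good_null] show ?thesis by blast
    next
      assume "\<exists>g0 c. (\<forall>t\<in>{0..1}. \<alpha> * G t \<le> (1 - a) * t) \<and> 1 \<le> g0 \<and> (\<forall>t\<in>{0..1}. G t \<le> g0 * t) \<and>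
         0 \<le> c \<and> 1 - a \<le> c * \<gamma> \<and> c * g0 \<le> 1 - b"
      then obtain g0 c where *: "\<And>t. t \<in> {0..1} \<Longrightarrow> \<alpha> * G t \<le> (1 - a) * t" "1 \<le> g0"
        "\<And>t. t \<in> {0..1} \<Longrightarrow> G t \<le> g0 * t" "0 \<le> c" "1 - a \<le> c * \<gamma>" "c * g0 \<le> 1 - b" by blast
      from expectation_fdp_le_density_small[OF setting *] show ?thesis by blast
    qed
    also have "prob B \<le> prob B1 + prob B2 + prob (miss m)"
      unfolding B_def
      using measure_Un_le[OF B1(1) B2(1)] measure_Un_le[OF sets.Un[OF B1(1) B2(1)] miss] by linarith
    also have "\<dots> \<le> r m" unfolding r_def using B1(2) B2(2) by simp
    finally show ?thesis unfolding T' by simp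
  qed
  ultimately show ?thesis by blast
qed

end
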